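(* Let $E(t)$ be associated with the solution $x(t;x_0)$, $t\ge0$, of $\dot x(t)=f(t,x)$, $x(0)=x_0$, where $f(t,x)$ is continuous in $t$ and locally Lipschitz in $x$ in an open neighbourhood of the solution $(t,x(t;x_0))$, $t\ge0$. Let $\alpha:[0,\infty)\to[0,\infty)$ be continuous and strictly increasing with $\alpha(0)=0$. Given $T>0$ and $\epsilon>0$, there exists $h_0>0$ such that $$\|\tilde x(t;x_0;h)-x(t;x_0)\|<(E(t)+\epsilon)\,\alpha(h)$$ for all $0\le t\le T$, all $0<h<h_0$, and any approximation $\tilde x(t;x_0;h)$ in the family $\tilde X_\alpha(x_0;h)$.
   Context: Norms are Euclidean. "Locally Lipschitz in $x$" means that each point $(t,x)$ has a neighbourhood on which $f$ is Lipschitz in $x$ with a constant independent of $t$. Let $x(t;s,\xi)$ be the solution of $\dot x=f(t,x)$ with $x(s)=\xi$, and $x(t;x_0)=x(t;0,x_0)$, assumed to exist for all $t\ge0$. For $h>0$, $\tilde X_\alpha(x_0;h)$ is the family of all functions $\tilde x(\cdot;x_0;h)$ obtained from sequences $v_1,v_2,\dots\in\mathbb{R}^d$ with $\|v_n\|\le1$ by $\tilde x(0;x_0;h)=x_0$, $\tilde x(nh;x_0;h)=x(nh;(n-1)h,\tilde x((n-1)h;x_0;h))+h\alpha(h)v_n$ for $n\ge1$, and $\tilde x(t;x_0;h)=x(t;(n-1)h,\tilde x((n-1)h;x_0;h))$ for $(n-1)h\le t<nh$. For every $T>0$ all these approximations exist on $[0,T]$ once $h$ is small enough. $E(t)$ associated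 with $x(t;x_0)$ is defined as $E_\alpha(t)$ for the zero solution of $\dot y=F(t,y):=f(t,y+x(t;x_0))-f(t,x(t;x_0))$, $y(0)=0$: with $\tilde Y_\alpha(h)$ the family of approximations $\tilde y(\cdot;h)$ built in the same way for $\dot y=F(t,y)$ starting from $\tilde y(0;h)=0$, put $e_\alpha(t;h)=\sup_{\tilde y\in\tilde Y_\alpha(h)}\|\tilde y(t;h)\|$ and $E_\alpha(t)=\limsup_{h\to0^+}e_\alpha(t;h)/\alpha(h)$ (this does not depend on the choice of $\alpha$). *)

theory Defs
  imports "HOL-Analysis.Analysis"
begin

text \<open>
  A right-hand side is a total function \<open>f\<close> together with the set \<open>U\<close> of points \<open>(t, x)\<close> that
  is regarded as its domain; a solution has to run inside \<open>U\<close>.  If \<open>I\<close> is a single point, the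
  derivative condition is void.
\<close>

definition ode_solution ::
    "(real \<Rightarrow> 'a \<Rightarrow> 'a) \<Rightarrow> (real \<times> 'a) set \<Rightarrow> real set \<Rightarrow> (real \<Rightarrow> 'a::real_normed_vector) \<Rightarrow> bool"
  where "ode_solution f U I x \<longleftrightarrow>
    (\<forall>t\<in>I. (t, x t) \<in> U \<and> (x has_vector_derivative f t (x t)) (at t within I))"

definition continuous_in_time ::
    "(real \<Rightarrow> 'a::real_normed_vector \<Rightarrow> 'a) \<Rightarrow> (real \<times> 'a) set \<Rightarrow> bool"
  where "continuous_in_time f U \<longleftrightarrow> (\<forall>x. continuous_on {t. (t, x) \<in> U} (\<lambda>t. f t x))"

text \<open>
  The library's \<open>local_lipschitz\<close> is restricted to product domains, hence this variant.
\<close>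

definition locally_lipschitz_in_state ::
    "(real \<Rightarrow> 'a::real_normed_vector \<Rightarrow> 'a) \<Rightarrow> (real \<times> 'a) set \<Rightarrow> bool"
  where "locally_lipschitz_in_state f U \<longleftrightarrow>
    (\<forall>(t, x)\<in>U. \<exists>r>0. \<exists>L. \<forall>s\<in>cball t r.
       L-lipschitz_on {y \<in> cball x r. (s, y) \<in> U} (f s))"

definition admissible_scale :: "(real \<Rightarrow> real) \<Rightarrow> bool"
  where "admissible_scale \<alpha> \<longleftrightarrow>
    continuous_on {0..} \<alpha> \<and> strict_mono_on {0..} \<alpha> \<and> \<alpha> 0 = 0"

text \<open>
  The family of approximations with step \<open>h\<close> that exist on \<open>[0, T]\<close>; the values of its members
  outside \<open>[0, T]\<close> are irrelevant.  In step \<open>n\<close>, the function \<open>\<phi>\<close> is the exact solution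
  through the approximate value at time \<open>(n - 1) h\<close>; it is needed only up to time \<open>T\<close>.
\<close>

definition approximations ::
    "(real \<Rightarrow> 'a \<Rightarrow> 'a) \<Rightarrow> (real \<times> 'a) set \<Rightarrow> (real \<Rightarrow> real) \<Rightarrow> 'a \<Rightarrow> real \<Rightarrow> real
      \<Rightarrow> (real \<Rightarrow> 'a::real_normed_vector) set"
  where "approximations f U \<alpha> \<xi> h T =
    {z. z 0 = \<xi> \<and>
        (\<exists>v :: nat \<Rightarrow> 'a. (\<forall>n\<ge>1. norm (v n) \<le> 1) \<and>
          (\<forall>n\<ge>1. (real n - 1) * h \<le> T \<longrightarrow>
            (\<exists>\<phi>. \<phi> ((real n - 1) * h) = z ((real n - 1) * h) \<and>
                 ode_solution f U {(real n - 1) * h .. min (real n * h) T} \<phi> \<and>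
                 (\<forall>t. (real n - 1) * h \<le> t \<and> t < real n * h \<and> t \<le> T \<longrightarrow> z t = \<phi> t) \<and>
                 (real n * h \<le> T \<longrightarrow>
                    z (real n * h) = \<phi> (real n * h) + (h * \<alpha> h) *\<^sub>R v n))))}"

text \<open>
  Supremum and upper limit are taken in the extended reals, where they always exist.
\<close>

definition zero_error ::
    "(real \<Rightarrow> 'a \<Rightarrow> 'a) \<Rightarrow> (real \<times> 'a::real_normed_vector) set \<Rightarrow> (real \<Rightarrow> real) \<Rightarrow> real \<Rightarrow> real \<Rightarrow> ereal"
  where "zero_error F V \<alpha> t h = (SUP y\<in>approximations F V \<alpha> 0 h t. ereal (norm (y t)))"

definition zero_growth ::
    "(real \<Rightarrow> 'a \<Rightarrow> 'a) \<Rightarrow> (real \<times> 'a::real_normed_vector) set \<Rightarrow> (real \<Rightarrow> real) \<Rightarrow> real \<Rightarrow> ereal"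
  where "zero_growth F V \<alpha> t =
    Limsup (at_right 0) (\<lambda>h. zero_error F V \<alpha> t h / ereal (\<alpha> h))"

text \<open>
  \<open>E(t)\<close> for the solution \<open>x\<close>: the previous quantity for the zero solution of the equation
  satisfied by the deviation from \<open>x\<close>, on the correspondingly shifted domain.
  For admissible scales, the value does not depend on the choice of \<open>\<alpha>\<close> under the standing
  hypotheses on \<open>f\<close>, so the scale here need not be the one of the approximations it bounds.
\<close>

definition associated_E ::
    "(real \<Rightarrow> 'a \<Rightarrow> 'a) \<Rightarrow> (real \<times> 'a::real_normed_vector) set \<Rightarrow> (real \<Rightarrow> 'a) \<Rightarrow> (real \<Rightarrow> real) \<Rightarrow> real \<Rightarrow> ereal"
  where "associated_E f U x \<alpha> =
    zero_growth (\<lambda>t y. f t (y + x t) - f t (x t)) {(t, y). (t, y + x t) \<in> U} \<alpha>"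

end

theory Submission imports Defs begin

text \<open>
  The deviation \<open>y = xt - x\<close> of an approximation solves the integral equation
  \<open>y(t) = \<integral> F(s, y(s)) ds + \<alpha>(h) w(t)\<close> over \<open>[0, t]\<close>, where \<open>w\<close> is the step function of the
  accumulated perturbations \<open>h v\<^sub>n\<close>.  Near the solution \<open>F\<close> is Lipschitz with one constant on
  \<open>[0, T]\<close>, so \<open>y\<close> depends on \<open>w\<close> in a Lipschitz manner.  The piecewise linear interpolation of
  \<open>w\<close> has Lipschitz constant 1, so sampling it with another step \<open>h'\<close> changes \<open>w\<close> by at most
  \<open>h + h'\<close>.  Choosing \<open>h'\<close> with \<open>\<beta>(h') = \<alpha>(h)\<close>, one obtains that the error quotients for \<open>\<alpha>\<close> and
  \<open>\<beta>\<close> differ by \<open>O(h + h')\<close>.  These quotients are equi-Lipschitz in \<open>t\<close> up to \<open>O(h)\<close>, hence their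
  pointwise upper limit \<open>E\<close> bounds them uniformly on the compact interval \<open>[0, T]\<close>.
\<close>

section \<open>Integral equations driven by a perturbation\<close>

text \<open>The equation \<open>y s = w s + \<integral> F r (y r) dr\<close> in Henstock form.
  Integrability along \<open>y\<close> is part of it, and \<open>y\<close> may jump together with
  \<open>w\<close>, which a differential equation would exclude.\<close>

definition driven ::
    "(real \<Rightarrow> 'a \<Rightarrow> 'a) \<Rightarrow> (real \<Rightarrow> 'a) \<Rightarrow> real \<Rightarrow> (real \<Rightarrow> 'a::euclidean_space) \<Rightarrow> bool"
  where "driven F w t y \<longleftrightarrow>
    (\<forall>s\<in>{0..t}. ((\<lambda>r. F r (y r)) has_integral (y s - w s)) {0..s})"

lemma driven_mono: "driven F w t y \<Longrightarrow> s \<le> t \<Longrightarrow> driven F w s y"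
  by (auto simp: driven_def)

lemma driven_zero: "(\<And>s. 0 \<le> s \<Longrightarrow> s \<le> t \<Longrightarrow> F s 0 = 0) \<Longrightarrow> driven F (\<lambda>_. 0) t (\<lambda>_. 0)"
  by (auto simp: driven_def intro!: has_integral_is_0)

lemma driven_compare:
  fixes F :: "real \<Rightarrow> 'a::euclidean_space \<Rightarrow> 'a"
  assumes L: "0 \<le> L" and lip: "\<And>s. 0 \<le> s \<Longrightarrow> s \<le> t \<Longrightarrow> L-lipschitz_on (cball 0 \<rho>) (F s)"
    and y: "driven F w t y" and y': "driven F w' t y'"
    and tube: "\<And>s. 0 \<le> s \<Longrightarrow> s \<le> t \<Longrightarrow> norm (y s) \<le> \<rho>"
    and tube': "\<And>s. 0 \<le> s \<Longrightarrow> s \<le> t \<Longrightarrow> norm (y' s) \<le> \<rho>"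
    and c: "\<And>s. 0 \<le> s \<Longrightarrow> s \<le> t \<Longrightarrow> norm (w s - w' s) \<le> c"
    and s: "0 \<le> s" "s \<le> t"
  shows "norm (y s - y' s) \<le> 2 * c * exp (2 * L * s)"
proof -
  text \<open>
    Weighting with \<open>exp (- 2 L r)\<close> makes the integral term a contraction with factor 1/2, which
    replaces Gronwall's inequality and needs no integrability of \<open>norm (y r - y' r)\<close>.
  \<close>
  define g where "g r = norm (y r - y' r) * exp (- 2 * L * r)" for r
  define M where "M = (SUP r\<in>{0..t}. g r)"
  have ne: "{0..t} \<noteq> {}" using s by auto
  \<comment> \<open>The common tube makes the supremum \<open>M\<close> finite, so that the
    inequality \<open>M \<le> c + M / 2\<close> reached below can be solved for
    \<open>M\<close>.\<close>
  have gle: "g r \<le> 2 * \<rho>" if "0 \<le> r" "r \<le> t" for r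
  proof -
    have "norm (y r - y' r) \<le> 2 * \<rho>"
      using norm_triangle_ineq4[of "y r" "y' r"] tube[OF that] tube'[OF that] by linarith
    moreover have "exp (- 2 * L * r) \<le> 1" using L that by simp
    ultimately show ?thesis unfolding g_def
      by (meson exp_ge_zero mult_left_le norm_ge_zero order_trans)
  qed
  have bdd: "bdd_above (g ` {0..t})"
    by (rule bdd_aboveI[of _ "2 * \<rho>"]) (auto simp: gle)
  have gM: "g r \<le> M" if "0 \<le> r" "r \<le> t" for r
    unfolding M_def by (rule cSUP_upper) (use that bdd in auto)
  have M0: "0 \<le> M" using gM[OF s] by (rule order_trans[rotated]) (simp add: g_def)
  have nle: "norm (y r - y' r) \<le> M * exp (2 * L * r)" if "0 \<le> r" "r \<le> t" for r
    using gM[OF that] by (simp add: g_def exp_minus field_simps)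
  have c0: "0 \<le> c" using c[OF s] norm_ge_zero order_trans by blast
  have "g r \<le> c + M / 2" if r: "0 \<le> r" "r \<le> t" for r
  proof -
    let ?G = "\<lambda>q. F q (y q) - F q (y' q)"
    have G: "(?G has_integral (y r - w r - (y' r - w' r))) {0..r}"
      using y y' r by (intro has_integral_diff) (auto simp: driven_def)
    have B: "((\<lambda>q. L * M * exp (2 * L * q)) has_integral
        (M / 2 * exp (2 * L * r) - M / 2 * exp (2 * L * 0))) {0..r}"
      by (rule fundamental_theorem_of_calculus)
        (auto intro!: derivative_eq_intros r simp: has_real_derivative_iff_has_vector_derivative[symmetric])
    have "norm (?G q) \<le> L * M * exp (2 * L * q)" if q: "q \<in> {0..r}" for q
    proof -
      have "norm (?G q) \<le> L * norm (y q - y' q)"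
        using lipschitz_onD[OF lip, of q "y q" "y' q"] q r tube[of q] tube'[of q]
        by (auto simp: dist_norm)
      also have "\<dots> \<le> L * (M * exp (2 * L * q))"
        by (intro mult_left_mono nle L) (use q r in auto)
      finally show ?thesis by (simp add: mult_ac)
    qed
    then have "norm (y r - w r - (y' r - w' r)) \<le> M / 2 * exp (2 * L * r) - M / 2 * exp (2 * L * 0)"
      using integral_norm_bound_integral[OF has_integral_integrable[OF G] has_integral_integrable[OF B]]
      by (simp add: integral_unique[OF G] integral_unique[OF B] del: integral_mult_right)
    also have "\<dots> \<le> M / 2 * exp (2 * L * r)" using M0 by simp
    finally have "norm (y r - w r - (y' r - w' r)) \<le> M / 2 * exp (2 * L * r)" .
    moreover have "y r - y' r = (y r - w r - (y' r - w' r)) + (w r - w' r)" by simp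
    ultimately have "norm (y r - y' r) \<le> M / 2 * exp (2 * L * r) + c"
      using c[OF r] norm_triangle_le by (metis add_mono)
    also have "\<dots> \<le> M / 2 * exp (2 * L * r) + c * exp (2 * L * r)"
      using c0 L r by (simp add: mult_le_cancel_left1)
    finally show ?thesis by (simp add: g_def exp_minus field_simps)
  qed
  then have "M \<le> c + M / 2"
    unfolding M_def by (intro cSUP_least ne) auto
  then have "M \<le> 2 * c" by simp
  then show ?thesis
    using nle[OF s] by (meson exp_ge_zero mult_right_mono order_trans)
qed

text \<open>A bootstrap: \<open>y\<close> is not assumed to stay in the ball. While it does,
  comparison with the zero solution bounds it by \<open>2 * c * exp (2 * L * t)\<close>. By
  \<open>small\<close> this keeps \<open>y - w\<close> strictly below \<rho>/2, so a first time at
  which \<open>y - w\<close> reaches \<rho>/2 cannot exist.\<close>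

lemma driven_bound:
  fixes F :: "real \<Rightarrow> 'a::euclidean_space \<Rightarrow> 'a"
  assumes L: "0 \<le> L" and lip: "\<And>s. 0 \<le> s \<Longrightarrow> s \<le> t \<Longrightarrow> L-lipschitz_on (cball 0 \<rho>) (F s)"
    and F0: "\<And>s. 0 \<le> s \<Longrightarrow> s \<le> t \<Longrightarrow> F s 0 = 0"
    and y: "driven F w t y"
    and c: "\<And>s. 0 \<le> s \<Longrightarrow> s \<le> t \<Longrightarrow> norm (w s) \<le> c"
    and small: "(1 + 2 * exp (2 * L * t)) * c < \<rho> / 2"
    and s: "0 \<le> s" "s \<le> t"
  shows "norm (y s) \<le> 2 * c * exp (2 * L * t)"
proof -
  have c0: "0 \<le> c" using c[OF s] norm_ge_zero order_trans by blast
  have "c \<le> (1 + 2 * exp (2 * L * t)) * c" 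
    using c0 mult_right_mono[of 1 "1 + 2 * exp (2 * L * t)" c] by simp
  then have c\<rho>: "c < \<rho> / 2" using small by simp
  have inside: "norm (y r) \<le> 2 * c * exp (2 * L * t)"
    if b: "b \<le> t" and tube: "\<And>q. 0 \<le> q \<Longrightarrow> q \<le> b \<Longrightarrow> norm (y q) \<le> \<rho>" 
      and r: "0 \<le> r" "r \<le> b" for b r
  proof -
    have "norm (y r - 0) \<le> 2 * c * exp (2 * L * r)"
      by (rule driven_compare[where t = b and F = F and w = w and w' = "\<lambda>_. 0" and y' = "\<lambda>_. 0" and \<rho> = \<rho>])
        (use L lip F0 c b tube r y c\<rho> c0 in \<open>auto intro!: driven_zero driven_mono[OF y]\<close>)
    also have "\<dots> \<le> 2 * c * exp (2 * L * t)"
      using c0 L r b by (intro mult_left_mono) (auto intro!: mult_left_mono)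
    finally show ?thesis by simp
  qed
  \<comment> \<open>\<open>y\<close> inherits the jumps of \<open>w\<close>, so a first-exit
    argument for \<open>y\<close> itself would fail. The integral part \<open>u\<close> is
    continuous, and \<open>w\<close>, being smaller than \<rho>/2, fits into the other half of the
    radius.\<close>
  define u where "u r = y r - w r" for r
  have u: "((\<lambda>r. F r (y r)) has_integral u r) {0..r}" if "0 \<le> r" "r \<le> t" for r
    using y that by (auto simp: driven_def u_def)
  have cont: "continuous_on {0..t} u"
  proof -
    have "continuous_on {0..t} (\<lambda>r. integral {0..r} (\<lambda>r. F r (y r)))"
      by (rule indefinite_integral_continuous_1) (use u[of t] s in auto)
    then show ?thesis
      by (rule continuous_on_eq) (use u in \<open>auto intro!: integral_unique\<close>)
  qed
  have "norm (u r) < \<rho> / 2" if r: "0 \<le> r" "r \<le> t" for r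
  proof (rule ccontr)
    assume neg: "\<not> norm (u r) < \<rho> / 2"
    have u0: "u 0 = 0" using u[of 0] s has_integral_unique[OF _ has_integral_refl(2)] by auto
    have contu: "continuous_on {0..r} (\<lambda>r. norm (u r))"
      by (intro continuous_intros continuous_on_subset[OF cont]) (use r in auto)
    note ivt = IVT'[OF _ _ _ continuous_on_subset[OF contu], where a = 0]
    text \<open>\<open>Inf C\<close> is the first time at which \<open>u\<close> leaves the ball of radius \<open>\<rho> / 2\<close>.\<close>
    define C where "C = {q \<in> {0..r}. norm (u q) = \<rho> / 2}"
    have C: "C = {0..r} \<inter> (\<lambda>r. norm (u r)) -` {\<rho> / 2}" by (auto simp: C_def)
    have "closed C"
      unfolding C by (rule continuous_closed_preimage[OF contu]) auto
    moreover have "C \<noteq> {}"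
      using ivt[of "\<rho> / 2" r] neg u0 r c\<rho> c0 by (auto simp: C_def)
    moreover have bdd: "bdd_below C" by (rule bdd_belowI[of _ 0]) (auto simp: C_def)
    ultimately have C1: "Inf C \<in> C" by (rule closed_contains_Inf[rotated 2])
    have le: "norm (u q) \<le> \<rho> / 2" if q: "0 \<le> q" "q \<le> Inf C" for q
    proof (rule ccontr)
      assume n: "\<not> norm (u q) \<le> \<rho> / 2"
      then obtain q' where q': "0 \<le> q'" "q' \<le> q" "norm (u q') = \<rho> / 2"
        using ivt[of "\<rho> / 2" q] u0 q C1 c\<rho> c0 by (auto simp: C_def)
      then have "q' \<in> C" using q C1 by (auto simp: C_def)
      then have "Inf C \<le> q'" using bdd by (rule cInf_lower)
      then have "q' = q" using q q' by simp
      then show False using q' n by simp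
    qed
    have tube: "norm (y q) \<le> \<rho>" if "0 \<le> q" "q \<le> Inf C" for q
      using norm_triangle_ineq[of "u q" "w q"] c[of q] le[of q] c\<rho> that C1 r
      by (auto simp: u_def C_def)
    have "norm (y (Inf C)) \<le> 2 * c * exp (2 * L * t)"
      by (rule inside[of "Inf C"]) (use tube C1 r in \<open>auto simp: C_def\<close>)
    then have "norm (u (Inf C)) \<le> (1 + 2 * exp (2 * L * t)) * c"
      using norm_triangle_ineq4[of "y (Inf C)" "w (Inf C)"] c[of "Inf C"] C1 r
      by (auto simp: u_def C_def algebra_simps)
    then show False using small C1 by (auto simp: C_def)
  qed
  then have "norm (y r) \<le> \<rho>" if "0 \<le> r" "r \<le> t" for r
    using norm_triangle_ineq[of "u r" "w r"] c[OF that] c\<rho> that by (force simp: u_def)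
  then show ?thesis using inside[of t s] s by auto
qed

section \<open>Local existence for a globally Lipschitz right-hand side\<close>

text \<open>Picard iteration: the interval is so short that the integral operator contracts by 1/2
  in the supremum norm. Continuity of \<open>G\<close> is required only along continuous curves,
  which is the form in which it is integrated.\<close>

lemma ode_local_existence:
  fixes G :: "real \<Rightarrow> 'a::euclidean_space \<Rightarrow> 'a"
  assumes ab: "a \<le> b" and L: "0 \<le> L" "L * (b - a) \<le> 1 / 2"
    and lip: "\<And>s. a \<le> s \<Longrightarrow> s \<le> b \<Longrightarrow> L-lipschitz_on UNIV (G s)"
    and cont: "\<And>y. continuous_on {a..b} y \<Longrightarrow> continuous_on {a..b} (\<lambda>s. G s (y s))"
  shows "\<exists>\<phi>. \<phi> a = p \<and> ode_solution G UNIV {a..b} \<phi>"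
proof -
  \<comment> \<open>Clamping time to \<open>{a..b}\<close> turns the iterates into bounded
    continuous functions on the whole line, so that Banach's theorem applies in the complete space
    of such functions.\<close>
  define cl where "cl t = max a (min b t)" for t :: real
  have cl: "cl t \<in> {a..b}" "t \<in> {a..b} \<Longrightarrow> cl t = t" for t using ab by (auto simp: cl_def)
  have contcl: "continuous_on UNIV cl" unfolding cl_def by (intro continuous_intros)
  define P where "P y t = p + integral {a..cl t} (\<lambda>s. G s (y s))" for y t
  have contG: "continuous_on {a..b} (\<lambda>s. G s (apply_bcontfun y s))" for y :: "real \<Rightarrow>\<^sub>C 'a"
    by (rule cont) simp
  have intG: "(\<lambda>s. G s (apply_bcontfun y s)) integrable_on {a..t}" if "t \<le> b" for y :: "real \<Rightarrow>\<^sub>C 'a" and t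
    by (rule integrable_continuous_real, rule continuous_on_subset[OF contG]) (use that in auto)
  have P: "P (apply_bcontfun y) \<in> bcontfun" for y :: "real \<Rightarrow>\<^sub>C 'a"
  proof -
    let ?I = "\<lambda>t. p + integral {a..t} (\<lambda>s. G s (y s))"
    have c: "continuous_on {a..b} ?I"
      by (intro continuous_intros indefinite_integral_continuous_1 intG) simp
    have "bounded (?I ` {a..b})"
      by (intro compact_imp_bounded compact_continuous_image c) simp
    then have "bounded (range (P y))"
      by (rule bounded_subset) (use cl in \<open>auto simp: P_def\<close>)
    moreover have "continuous_on UNIV (P y)"
      unfolding P_def
      by (rule continuous_on_compose2[OF c contcl]) (use cl in auto)
    ultimately show ?thesis by (simp add: bcontfun_def)
  qed
  define Q where "Q y = Bcontfun (P (apply_bcontfun y))" for y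
  have Q: "apply_bcontfun (Q y) = P (apply_bcontfun y)" for y
    unfolding Q_def by (rule Bcontfun_inverse) (rule P)
  have "\<exists>!y. Q y = y"
  proof (rule banach_fix_type)
    show "0 \<le> (1 / 2 :: real)" "(1 / 2 :: real) < 1" by auto
    show "\<forall>y z. dist (Q y) (Q z) \<le> 1 / 2 * dist y z"
    proof (intro allI)
      fix y z
      show "dist (Q y) (Q z) \<le> 1 / 2 * dist y z"
      proof (rule dist_bound)
        fix t
        have "norm (integral {a..cl t} (\<lambda>s. G s (y s) - G s (z s))) \<le> L * dist y z * (cl t - a)"
        proof (rule integral_bound)
          show "a \<le> cl t" using cl(1)[of t] by simp
          show "continuous_on {a..cl t} (\<lambda>s. G s (y s) - G s (z s))"
            by (intro continuous_intros continuous_on_subset[OF contG]) (use cl(1)[of t] in auto)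
          fix s assume s: "s \<in> {a..cl t}"
          then have "dist (G s (y s)) (G s (z s)) \<le> L * dist (y s) (z s)"
            using cl(1)[of t] by (intro lipschitz_onD[OF lip]) auto
          also have "\<dots> \<le> L * dist y z" by (intro mult_left_mono dist_bounded L)
          finally show "norm (G s (y s) - G s (z s)) \<le> L * dist y z" by (simp add: dist_norm)
        qed
        also have "\<dots> \<le> L * dist y z * (b - a)"
          using cl(1)[of t] L by (intro mult_left_mono) auto
        also have "\<dots> \<le> 1 / 2 * dist y z"
          using mult_right_mono[OF L(2), of "dist y z"] by (simp add: mult_ac)
        finally show "dist (Q y t) (Q z t) \<le> 1 / 2 * dist y z"
          unfolding Q P_def dist_norm using cl(1)[of t] by (simp add: integral_diff intG)
      qed
    qed
  qed
  then obtain y where y: "Q y = y" by auto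
  then have y: "apply_bcontfun y = P (apply_bcontfun y)" using Q[of y] by simp
  have der: "((\<lambda>t. p + integral {a..t} (\<lambda>s. G s (y s))) has_vector_derivative G t (y t)) (at t within {a..b})"
    if "t \<in> {a..b}" for t
    using integral_has_vector_derivative[OF contG that, of y]
    by (auto intro!: derivative_eq_intros)
  have eq: "p + integral {a..t} (\<lambda>s. G s (y s)) = y t" if "t \<in> {a..b}" for t
    using fun_cong[OF y, of t] that by (simp add: P_def cl)
  have "(y has_vector_derivative G t (y t)) (at t within {a..b})" if "t \<in> {a..b}" for t
    by (rule has_vector_derivative_transform[OF that _ der[OF that]]) (use eq in simp)
  moreover have "apply_bcontfun y a = p" using ab by (subst y) (simp add: P_def cl)
  ultimately show ?thesis by (auto simp: ode_solution_def)
qed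

section \<open>Step functions and stepwise approximations\<close>

text \<open>The impulse due at time \<open>n * h\<close> counts as received at that time. This
  matches approximations, whose value at a grid point is the one after the jump.\<close>

definition impulses :: "real \<Rightarrow> (nat \<Rightarrow> 'a::real_normed_vector) \<Rightarrow> real \<Rightarrow> 'a"
  where "impulses h v t = h *\<^sub>R (\<Sum>n=1..nat \<lfloor>t / h\<rfloor>. v n)"

lemma floor_step:
  assumes "0 < h" "real k * h \<le> t" "t < (real k + 1) * h"
  shows "nat \<lfloor>t / h\<rfloor> = k"
proof -
  have "\<lfloor>t / h\<rfloor> = int k"
    by (rule floor_unique) (use assms in \<open>simp_all add: field_simps\<close>)
  then show ?thesis by simp
qed

lemma floor_bounds:
  assumes "0 < h" "0 \<le> t"
  shows "real (nat \<lfloor>t / h\<rfloor>) * h \<le> t" "t < (real (nat \<lfloor>t / h\<rfloor>) + 1) * h"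
proof -
  have e: "real (nat \<lfloor>t / h\<rfloor>) = of_int \<lfloor>t / h\<rfloor>" using assms by simp
  have "of_int \<lfloor>t / h\<rfloor> \<le> t / h" "t / h < of_int \<lfloor>t / h\<rfloor> + 1" by linarith+
  then have "of_int \<lfloor>t / h\<rfloor> * h \<le> t" "t < (of_int \<lfloor>t / h\<rfloor> + 1) * h"
    using assms(1) by (simp_all only: pos_le_divide_eq pos_divide_less_eq)
  then show "real (nat \<lfloor>t / h\<rfloor>) * h \<le> t" "t < (real (nat \<lfloor>t / h\<rfloor>) + 1) * h"
    unfolding e by auto
qed

lemma impulses_multiple: "0 < h \<Longrightarrow> impulses h v (real k * h) = h *\<^sub>R (\<Sum>n=1..k. v n)"
  by (simp add: impulses_def)

text \<open>At most \<open>(t - s) / h + 1\<close> grid points lie in the interval after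
  \<open>s\<close> up to \<open>t\<close>, and each contributes at most \<open>h\<close>; the extra
  one produces the term \<open>h\<close>.\<close>

lemma impulses_diff:
  assumes h: "0 < h" and v: "\<And>n. 1 \<le> n \<Longrightarrow> norm (v n) \<le> 1" and st: "0 \<le> s" "s \<le> t"
  shows "norm (impulses h v t - impulses h v s) \<le> t - s + h"
proof -
  let ?k = "\<lambda>t. nat \<lfloor>t / h\<rfloor>"
  have kk: "?k s \<le> ?k t" using h st by (intro nat_mono floor_mono divide_right_mono) auto
  have "{1..?k t} = {1..?k s} \<union> {Suc (?k s)..?k t}" using kk by auto
  then have "(\<Sum>n=1..?k t. v n) = (\<Sum>n=1..?k s. v n) + (\<Sum>n=Suc (?k s)..?k t. v n)"
    by (simp only:) (rule sum.union_disjoint, auto)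
  then have "impulses h v t - impulses h v s = h *\<^sub>R (\<Sum>n=Suc (?k s)..?k t. v n)"
    by (simp add: impulses_def algebra_simps)
  also have "norm \<dots> \<le> h * real (?k t - ?k s)"
    using sum_norm_le[of "{Suc (?k s)..?k t}" v "\<lambda>_. 1"] v h by simp
  also have "\<dots> \<le> t - s + h"
    using floor_bounds[OF h, of s] floor_bounds[OF h, of t] st kk
    by (simp add: of_nat_diff algebra_simps)
  finally show ?thesis .
qed

lemma impulses_bound:
  assumes h: "0 < h" and v: "\<And>n. 1 \<le> n \<Longrightarrow> norm (v n) \<le> 1" and t: "0 \<le> t"
  shows "norm (impulses h v t) \<le> t"
proof -
  have "norm (impulses h v t) \<le> h * real (nat \<lfloor>t / h\<rfloor>)"
    using sum_norm_le[of "{1..nat \<lfloor>t / h\<rfloor>}" v "\<lambda>_. 1"] v h by (simp add: impulses_def)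
  also have "\<dots> \<le> t" using floor_bounds(1)[OF h t] by (simp add: mult.commute)
  finally show ?thesis .
qed

text \<open>Both step functions agree on their own grids with one curve \<open>P\<close> of
  Lipschitz constant 1. Between grid points each lags behind \<open>P\<close> by at most its step,
  hence the bound \<open>h + h'\<close>.\<close>

lemma impulses_resample:
  fixes v :: "nat \<Rightarrow> 'a::real_normed_vector"
  assumes h: "0 < h" and h': "0 < h'" and v: "\<And>n. 1 \<le> n \<Longrightarrow> norm (v n) \<le> 1"
  shows "\<exists>v'. (\<forall>n\<ge>1. norm (v' n) \<le> 1) \<and>
    (\<forall>t\<in>{0..T}. norm (impulses h v t - impulses h' v' t) \<le> h + h')"
proof -
  define N where "N = nat \<lceil>T / h\<rceil>"
  \<comment> \<open>The part of step \<open>n\<close> elapsed by time \<open>t\<close>, clipped to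
    lie between 0 and \<open>h\<close>. These portions are nondecreasing in \<open>t\<close> and sum
    to \<open>min t (M * h)\<close>, which is why \<open>P\<close> has Lipschitz constant 1.\<close>
  define r where "r n t = max 0 (min h (t - (real n - 1) * h))" for n t
  text \<open>\<open>P\<close> is the piecewise linear interpolation of \<open>impulses h v\<close> on \<open>[0, N h]\<close>.\<close>
  define P where "P t = (\<Sum>n=1..N. r n t *\<^sub>R v n)" for t
  have rsum: "(\<Sum>n=1..M. r n t) = min t (real M * h)" if "0 \<le> t" for t M
    using that h by (induction M) (auto simp: r_def min_def max_def algebra_simps)
  have lip: "norm (P t - P s) \<le> t - s" if st: "0 \<le> s" "s \<le> t" for s t
  proof -
    have "norm (P t - P s) = norm (\<Sum>n=1..N. (r n t - r n s) *\<^sub>R v n)"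
      by (simp add: P_def sum_subtractf scaleR_diff_left)
    also have "\<dots> \<le> (\<Sum>n=1..N. r n t - r n s)"
    proof (rule sum_norm_le)
      fix n assume n: "n \<in> {1..N}"
      have "0 \<le> r n t - r n s" using st by (auto simp: r_def)
      then show "norm ((r n t - r n s) *\<^sub>R v n) \<le> r n t - r n s"
        using v[of n] n by (simp add: mult_left_le)
    qed
    also have "\<dots> \<le> t - s"
      using st rsum[of t N] rsum[of s N] by (simp add: sum_subtractf min_def)
    finally show ?thesis .
  qed
  have Pk: "P (real k * h) = impulses h v (real k * h)" if k: "k \<le> N" for k
  proof -
    have "P (real k * h) = (\<Sum>n=1..k. r n (real k * h) *\<^sub>R v n)"
      unfolding P_def
    proof (rule sum.mono_neutral_right)
      show "\<forall>i\<in>{1..N} - {1..k}. r i (real k * h) *\<^sub>R v i = 0"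
      proof
        fix i assume "i \<in> {1..N} - {1..k}"
        then have "real k \<le> real i - 1" by auto
        then have "real k * h \<le> (real i - 1) * h" using h by (intro mult_right_mono) auto
        then show "r i (real k * h) *\<^sub>R v i = 0" by (simp add: r_def)
      qed
    qed (use k in auto)
    also have "\<dots> = (\<Sum>n=1..k. h *\<^sub>R v n)"
    proof (rule sum.cong)
      fix i assume "i \<in> {1..k}"
      then have "real i * h \<le> real k * h" using h by (intro mult_right_mono) auto
      then show "r i (real k * h) *\<^sub>R v i = h *\<^sub>R v i"
        using h by (simp add: r_def algebra_simps)
    qed simp
    finally show ?thesis using impulses_multiple[OF h, of v k] by (simp add: scaleR_sum_right)
  qed
  have P0: "P 0 = 0" using Pk[of 0] by (simp add: impulses_def)
  have near: "norm (impulses h v t - P t) \<le> h" if t: "0 \<le> t" "t \<le> T" for t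
  proof -
    define k where "k = nat \<lfloor>t / h\<rfloor>"
    have k: "real k * h \<le> t" "t < (real k + 1) * h"
      using floor_bounds[OF h t(1)] by (auto simp: k_def)
    have "t / h \<le> T / h" using t h by (simp add: divide_right_mono)
    then have "k \<le> N" unfolding k_def N_def by (intro nat_mono) linarith
    then have "impulses h v t = P (real k * h)"
      using Pk[of k] impulses_multiple[OF h, of v k] by (simp add: impulses_def k_def)
    then have "norm (impulses h v t - P t) = norm (P t - P (real k * h))"
      by (simp add: norm_minus_commute)
    also have "\<dots> \<le> t - real k * h" by (rule lip) (use k h in auto)
    also have "\<dots> \<le> h" using k by (simp add: algebra_simps)
    finally show ?thesis .
  qed
  \<comment> \<open>The mean slope of \<open>P\<close> over the n-th step of length
    \<open>h'\<close>. After time \<open>N * h\<close> the curve is constant, so these vectors are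
    admissible for every \<open>n \<ge> 1\<close>, also beyond \<open>T\<close>.\<close>
  define v' where "v' n = (P (real n * h') - P ((real n - 1) * h')) /\<^sub>R h'" for n
  have v': "norm (v' n) \<le> 1" if n: "1 \<le> n" for n
  proof -
    have "(real n - 1) * h' \<le> real n * h'" using h' by (intro mult_right_mono) auto
    then have "norm (P (real n * h') - P ((real n - 1) * h')) \<le> real n * h' - (real n - 1) * h'"
      using h' n by (intro lip) auto
    then show ?thesis
      unfolding v'_def norm_scaleR using h' by (simp add: left_diff_distrib field_simps)
  qed
  have imp': "impulses h' v' (real k * h') = P (real k * h')" for k
  proof -
    have "(\<Sum>n=1..k. h' *\<^sub>R v' n) = P (real k * h')"
    proof (induction k)
      case 0 then show ?case by (simp add: P0)
    next
      case (Suc k) then show ?case using h' by (simp add: v'_def)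
    qed
    then show ?thesis by (simp add: impulses_multiple[OF h'] scaleR_sum_right)
  qed
  have "norm (impulses h v t - impulses h' v' t) \<le> h + h'" if t: "0 \<le> t" "t \<le> T" for t
  proof -
    define k where "k = nat \<lfloor>t / h'\<rfloor>"
    have k: "real k * h' \<le> t" "t < (real k + 1) * h'"
      using floor_bounds[OF h' t(1)] by (auto simp: k_def)
    have "impulses h' v' t = P (real k * h')"
      using imp'[of k] impulses_multiple[OF h', of v' k] by (simp add: impulses_def k_def)
    moreover have "norm (P t - P (real k * h')) \<le> t - real k * h'"
      by (rule lip) (use k h' in auto)
    moreover have "t - real k * h' \<le> h'" using k by (simp add: algebra_simps)
    moreover have "norm (impulses h v t - P (real k * h'))
        \<le> norm (impulses h v t - P t) + norm (P t - P (real k * h'))"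
      using norm_triangle_ineq[of "impulses h v t - P t" "P t - P (real k * h')"] by simp
    ultimately show ?thesis using near[OF t] by simp
  qed
  then show ?thesis using v' by (intro exI[of _ v']) auto
qed

text \<open>
  \<^const>\<open>approximations\<close> for fixed perturbations, with the steps counted from 0 and the factor
  \<open>h * \<gamma> h\<close> replaced by \<open>c\<close>.
\<close>

definition stepwise ::
    "(real \<Rightarrow> 'a \<Rightarrow> 'a) \<Rightarrow> (real \<times> 'a) set \<Rightarrow> real \<Rightarrow> 'a \<Rightarrow> real \<Rightarrow> real \<Rightarrow> (nat \<Rightarrow> 'a)
      \<Rightarrow> (real \<Rightarrow> 'a::real_normed_vector) \<Rightarrow> bool"
  where "stepwise F V c \<xi> h T v z \<longleftrightarrow> z 0 = \<xi> \<and>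
    (\<forall>n. real n * h \<le> T \<longrightarrow>
      (\<exists>\<phi>. \<phi> (real n * h) = z (real n * h) \<and>
         ode_solution F V {real n * h .. min (real (Suc n) * h) T} \<phi> \<and>
         (\<forall>t. real n * h \<le> t \<and> t < real (Suc n) * h \<and> t \<le> T \<longrightarrow> z t = \<phi> t) \<and>
         (real (Suc n) * h \<le> T \<longrightarrow>
            z (real (Suc n) * h) = \<phi> (real (Suc n) * h) + c *\<^sub>R v (Suc n))))"

lemma all_ge_1_iff: "(\<forall>n\<ge>1. P n) \<longleftrightarrow> (\<forall>n. P (Suc n))"
  by (metis One_nat_def Suc_le_D le_add1 plus_1_eq_Suc)

lemma approximations_stepwise:
  "approximations F V \<gamma> \<xi> h T =
    {z. \<exists>v. (\<forall>n\<ge>1. norm (v n) \<le> 1) \<and> stepwise F V (h * \<gamma> h) \<xi> h T v z}"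
proof -
  have e: "real (Suc n) - 1 = real n" for n by simp
  show ?thesis
    unfolding approximations_def stepwise_def all_ge_1_iff e
    by (rule Collect_cong, intro iffI; elim conjE exE; intro conjI exI; assumption)
qed

lemma ode_solution_subset:
  "ode_solution F V I \<phi> \<Longrightarrow> J \<subseteq> I \<Longrightarrow> ode_solution F V J \<phi>"
  unfolding ode_solution_def by (meson has_vector_derivative_within_subset subsetD)

lemma stepwise_mono:
  assumes z: "stepwise F V c \<xi> h T v z" and "s \<le> T"
  shows "stepwise F V c \<xi> h s v z"
  unfolding stepwise_def
proof (intro conjI allI impI)
  fix n assume n: "real n * h \<le> s"
  with z assms obtain \<phi> where \<phi>: "\<phi> (real n * h) = z (real n * h)"
    "ode_solution F V {real n * h .. min (real (Suc n) * h) T} \<phi>"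
    "\<forall>t. real n * h \<le> t \<and> t < real (Suc n) * h \<and> t \<le> T \<longrightarrow> z t = \<phi> t"
    "real (Suc n) * h \<le> T \<longrightarrow> z (real (Suc n) * h) = \<phi> (real (Suc n) * h) + c *\<^sub>R v (Suc n)"
    using order_trans[OF n \<open>s \<le> T\<close>] unfolding stepwise_def by blast
  show "\<exists>\<phi>. \<phi> (real n * h) = z (real n * h) \<and>
         ode_solution F V {real n * h .. min (real (Suc n) * h) s} \<phi> \<and>
         (\<forall>t. real n * h \<le> t \<and> t < real (Suc n) * h \<and> t \<le> s \<longrightarrow> z t = \<phi> t) \<and>
         (real (Suc n) * h \<le> s \<longrightarrow>
            z (real (Suc n) * h) = \<phi> (real (Suc n) * h) + c *\<^sub>R v (Suc n))"
    using \<phi> assms by (intro exI[of _ \<phi>] conjI ode_solution_subset[OF \<phi>(2)]) auto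
qed (use z in \<open>simp add: stepwise_def\<close>)

text \<open>Within a step \<open>z\<close> is an exact solution, so the fundamental theorem gives
  its increment as an integral. Adding the steps leaves over exactly the jumps
  \<open>(h * \<eta>) *\<^sub>R v n\<close>, which accumulate to \<open>\<eta>\<close> times the
  impulses.\<close>

lemma stepwise_driven:
  fixes z :: "real \<Rightarrow> 'a::euclidean_space"
  assumes h: "0 < h" and z: "stepwise F V (h * \<eta>) 0 h T v z"
  shows "driven F (\<lambda>s. \<eta> *\<^sub>R impulses h v s) T z"
proof -
  let ?f = "\<lambda>r. F r (z r)"
  have piece: "\<exists>\<phi>. \<phi> (real n * h) = z (real n * h) \<and>
      (\<forall>s. real n * h \<le> s \<and> s \<le> real (Suc n) * h \<and> s \<le> T \<longrightarrow>
        (?f has_integral (\<phi> s - \<phi> (real n * h))) {real n * h..s}) \<and>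
      (\<forall>t. real n * h \<le> t \<and> t < real (Suc n) * h \<and> t \<le> T \<longrightarrow> z t = \<phi> t) \<and>
      (real (Suc n) * h \<le> T \<longrightarrow>
        z (real (Suc n) * h) = \<phi> (real (Suc n) * h) + (h * \<eta>) *\<^sub>R v (Suc n))"
    if n: "real n * h \<le> T" for n
  proof -
    from z n obtain \<phi> where \<phi>: "\<phi> (real n * h) = z (real n * h)"
      "ode_solution F V {real n * h .. min (real (Suc n) * h) T} \<phi>"
      "\<forall>t. real n * h \<le> t \<and> t < real (Suc n) * h \<and> t \<le> T \<longrightarrow> z t = \<phi> t"
      "real (Suc n) * h \<le> T \<longrightarrow> z (real (Suc n) * h) = \<phi> (real (Suc n) * h) + (h * \<eta>) *\<^sub>R v (Suc n)"
      unfolding stepwise_def by blast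
    have "(?f has_integral (\<phi> s - \<phi> (real n * h))) {real n * h..s}"
      if s: "real n * h \<le> s" "s \<le> real (Suc n) * h" "s \<le> T" for s
    proof (rule has_integral_spike_finite)
      \<comment> \<open>At the right end of the step \<open>z\<close> has already jumped and may
        differ from \<open>\<phi>\<close>; one point does not affect the integral.\<close>
      show "finite {real (Suc n) * h}" by simp
      show "((\<lambda>r. F r (\<phi> r)) has_integral (\<phi> s - \<phi> (real n * h))) {real n * h..s}"
      proof (rule fundamental_theorem_of_calculus)
        have "ode_solution F V {real n * h..s} \<phi>"
          by (rule ode_solution_subset[OF \<phi>(2)]) (use s in auto)
        then show "(\<phi> has_vector_derivative F r (\<phi> r)) (at r within {real n * h..s})"
          if "r \<in> {real n * h..s}" for r
          using that by (simp add: ode_solution_def)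
      qed (use s in auto)
      show "F r (z r) = F r (\<phi> r)" if "r \<in> {real n * h..s} - {real (Suc n) * h}" for r
        using \<phi>(3) that s by auto
    qed
    then show ?thesis using \<phi> by blast
  qed
  have at: "real n * h \<le> T \<Longrightarrow>
      (?f has_integral (z (real n * h) - (h * \<eta>) *\<^sub>R (\<Sum>k=1..n. v k))) {0..real n * h}" for n
  proof (induction n)
    case 0
    have "z 0 = 0" using z by (simp add: stepwise_def)
    then show ?case using has_integral_refl(2)[of ?f 0] by simp
  next
    case (Suc n)
    have le: "real n * h \<le> real (Suc n) * h" using h by simp
    with Suc have n: "real n * h \<le> T" by simp
    from piece[OF n] le Suc.prems obtain \<phi> where \<phi>: "\<phi> (real n * h) = z (real n * h)"
      "(?f has_integral (\<phi> (real (Suc n) * h) - \<phi> (real n * h))) {real n * h..real (Suc n) * h}"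
      "z (real (Suc n) * h) = \<phi> (real (Suc n) * h) + (h * \<eta>) *\<^sub>R v (Suc n)"
      by blast
    show ?case
      using has_integral_combine[OF _ le Suc.IH[OF n] \<phi>(2)] h \<phi>(1,3)
      by (simp add: algebra_simps)
  qed
  show ?thesis
    unfolding driven_def
  proof
    fix s assume s: "s \<in> {0..T}"
    define n where "n = nat \<lfloor>s / h\<rfloor>"
    have n: "real n * h \<le> s" "s < real (Suc n) * h"
      using floor_bounds[OF h, of s] s unfolding n_def by (auto simp: add.commute)
    then have nT: "real n * h \<le> T" using s by auto
    from piece[OF nT] n s obtain \<phi> where \<phi>: "\<phi> (real n * h) = z (real n * h)"
      "(?f has_integral (\<phi> s - \<phi> (real n * h))) {real n * h..s}" "z s = \<phi> s"
      by (metis atLeastAtMost_iff less_imp_le)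
    show "(?f has_integral (z s - \<eta> *\<^sub>R impulses h v s)) {0..s}"
      using has_integral_combine[OF _ n(1) at[OF nT] \<phi>(2)] h \<phi>(1,3)
      by (simp add: impulses_def n_def mult.commute algebra_simps)
  qed
qed

text \<open>Each step can be solved from any starting value because the Lipschitz condition is
  global and \<open>L * h \<le> 1 / 2\<close>. The pieces are glued along the recursively defined
  grid values \<open>p n\<close>.\<close>

lemma stepwise_exist:
  fixes G :: "real \<Rightarrow> 'a::euclidean_space \<Rightarrow> 'a"
  assumes h: "0 < h" and L: "0 \<le> L" "L * h \<le> 1 / 2"
    and lip: "\<And>s. 0 \<le> s \<Longrightarrow> s \<le> T \<Longrightarrow> L-lipschitz_on UNIV (G s)"
    and cont: "\<And>a b y. 0 \<le> a \<Longrightarrow> b \<le> T \<Longrightarrow> continuous_on {a..b} y \<Longrightarrow> continuous_on {a..b} (\<lambda>s. G s (y s))"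
  shows "\<exists>z. stepwise G UNIV c \<xi> h T v z"
proof -
  have "\<exists>\<phi>. real n * h \<le> T \<longrightarrow> \<phi> (real n * h) = p \<and>
      ode_solution G UNIV {real n * h .. min (real (Suc n) * h) T} \<phi>" for n p
  proof (cases "real n * h \<le> T")
    case True
    have "\<exists>\<phi>. \<phi> (real n * h) = p \<and> ode_solution G UNIV {real n * h .. min (real (Suc n) * h) T} \<phi>"
    proof (rule ode_local_existence[OF _ L(1)])
      have "min (real (Suc n) * h) T - real n * h \<le> h" by (simp add: algebra_simps min_def)
      from mult_left_mono[OF this L(1)] L(2)
      show "L * (min (real (Suc n) * h) T - real n * h) \<le> 1 / 2" by simp
      have n0: "0 \<le> real n * h" using h by simp
      show "L-lipschitz_on UNIV (G s)" if "real n * h \<le> s" "s \<le> min (real (Suc n) * h) T" for s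
        by (rule lip) (use that n0 in auto)
    qed (use True h in \<open>auto intro!: cont\<close>)
    then show ?thesis by blast
  qed auto
  then obtain \<Phi> where \<Phi>: "\<And>n p. real n * h \<le> T \<Longrightarrow> \<Phi> n p (real n * h) = p"
    "\<And>n p. real n * h \<le> T \<Longrightarrow> ode_solution G UNIV {real n * h .. min (real (Suc n) * h) T} (\<Phi> n p)"
    by metis
  define p where "p = rec_nat \<xi> (\<lambda>n q. \<Phi> n q (real (Suc n) * h) + c *\<^sub>R v (Suc n))"
  have p: "p 0 = \<xi>" "p (Suc n) = \<Phi> n (p n) (real (Suc n) * h) + c *\<^sub>R v (Suc n)" for n
    by (simp_all add: p_def)
  \<comment> \<open>The value at 0 is set separately so that \<open>z 0 = \<xi>\<close> also holds
    for negative \<open>T\<close>, where nothing is known about \<open>\<Phi>\<close>.\<close>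
  define z where "z t = (if t = 0 then \<xi> else \<Phi> (nat \<lfloor>t / h\<rfloor>) (p (nat \<lfloor>t / h\<rfloor>)) t)" for t
  have zk: "z (real n * h) = p n" if "real n * h \<le> T" for n
    using that \<Phi>(1)[of n "p n"] h by (auto simp: z_def p)
  show ?thesis
  proof (intro exI[of _ z], unfold stepwise_def, intro conjI allI impI)
    fix n assume n: "real n * h \<le> T"
    have "z t = \<Phi> n (p n) t" if "real n * h \<le> t" "t < real (Suc n) * h" "t \<le> T" for t
    proof (cases "t = real n * h")
      case False
      have "0 \<le> real n * h" using h by simp
      then have "t \<noteq> 0" using False that by linarith
      moreover have "nat \<lfloor>t / h\<rfloor> = n" by (rule floor_step[OF h]) (use that in \<open>auto simp: algebra_simps\<close>)
      ultimately show ?thesis by (simp add: z_def)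
    qed (use zk \<Phi> n in simp)
    then show "\<exists>\<phi>. \<phi> (real n * h) = z (real n * h) \<and>
         ode_solution G UNIV {real n * h .. min (real (Suc n) * h) T} \<phi> \<and>
         (\<forall>t. real n * h \<le> t \<and> t < real (Suc n) * h \<and> t \<le> T \<longrightarrow> z t = \<phi> t) \<and>
         (real (Suc n) * h \<le> T \<longrightarrow>
            z (real (Suc n) * h) = \<phi> (real (Suc n) * h) + c *\<^sub>R v (Suc n))"
      using \<Phi> zk n zk[of "Suc n"] p(2)[of n] by (intro exI[of _ "\<Phi> n (p n)"]) auto
  qed (simp add: z_def)
qed

section \<open>Approximations in a tube around the zero solution\<close>

lemma admissible_scale_pos: "admissible_scale \<gamma> \<Longrightarrow> 0 < h \<Longrightarrow> 0 < \<gamma> h"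
  unfolding admissible_scale_def by (metis atLeast_iff less_imp_le order_refl strict_mono_onD)

lemma admissible_scale_tendsto:
  assumes "admissible_scale \<gamma>"
  shows "(\<gamma> \<longlongrightarrow> 0) (at_right 0)"
proof -
  have "(\<gamma> \<longlongrightarrow> \<gamma> 0) (at 0 within {0..})"
    using assms unfolding admissible_scale_def continuous_on_def by blast
  then have "(\<gamma> \<longlongrightarrow> \<gamma> 0) (at_right 0)" by (rule tendsto_within_subset) auto
  then show ?thesis using assms by (simp add: admissible_scale_def)
qed

text \<open>What the deviation equation provides near its zero solution, with one radius and one
  Lipschitz constant for all of \<open>{0..T}\<close>. The estimates are carried out in this
  setting; \<open>tube_around_solution\<close> supplies it.\<close>

locale tube =
  fixes F :: "real \<Rightarrow> 'a::euclidean_space \<Rightarrow> 'a" and V :: "(real \<times> 'a) set" and L \<rho> T :: real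
  assumes L: "0 \<le> L" and \<rho>: "0 < \<rho>" and T: "0 < T"
    and sub: "\<And>s y. 0 \<le> s \<Longrightarrow> s \<le> T \<Longrightarrow> y \<in> cball 0 \<rho> \<Longrightarrow> (s, y) \<in> V"
    and lip: "\<And>s. 0 \<le> s \<Longrightarrow> s \<le> T \<Longrightarrow> L-lipschitz_on (cball 0 \<rho>) (F s)"
    and zero: "\<And>s. F s 0 = 0"
    and cont: "continuous_on ({0..T} \<times> cball 0 \<rho>) (\<lambda>(s, y). F s y)"
begin

text \<open>The factor from the smallness condition of \<open>driven_bound\<close>. It also
  dominates the factor \<open>2 * exp (2 * L * T)\<close> of the comparison estimate, so one
  constant serves both.\<close>

definition "K = 1 + 2 * exp (2 * L * T)"

text \<open>The rate of change of an approximation relative to its amplitude \<open>\<eta>\<close>: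
  the vector field is at most \<open>L * (K * T * \<eta>)\<close> along it, and the impulses add
  slope 1.\<close>

definition "C = L * (K * T) + 1"

text \<open>The conditions serve, in order, to solve a single step, to keep approximations within
  half the tube, and to keep their values before a jump within the tube. The amplitude \<eta> is a
  number separate from \<open>h\<close>, so that different steps can share it.\<close>

definition "small h \<eta> \<longleftrightarrow>
  0 < h \<and> L * h \<le> 1 / 2 \<and> 0 \<le> \<eta> \<and> K * (\<eta> * T) < \<rho> / 2 \<and> h * \<eta> \<le> \<rho> / 2"

lemma K_pos: "0 < K" by (simp add: K_def add_pos_pos)

lemma C_pos: "0 < C" using L K_pos T by (simp add: C_def add_nonneg_pos)

lemma impulses_scaled_bound:
  assumes "0 < h" "0 \<le> \<eta>" "\<And>n. 1 \<le> n \<Longrightarrow> norm (v n) \<le> 1" "0 \<le> s" "s \<le> T"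
  shows "norm (\<eta> *\<^sub>R impulses h v s) \<le> \<eta> * T"
  using order_trans[OF impulses_bound[of h v s] \<open>s \<le> T\<close>] assms by (simp add: mult_left_mono)

lemma stepwise_bound:
  assumes sm: "small h \<eta>" and v: "\<And>n. 1 \<le> n \<Longrightarrow> norm (v n) \<le> 1"
    and z: "stepwise F V (h * \<eta>) 0 h t v z" and t: "t \<le> T" and s: "0 \<le> s" "s \<le> t"
  shows "norm (z s) \<le> K * T * \<eta>" and "norm (z s) \<le> \<rho>"
proof -
  have c0: "0 \<le> \<eta> * T" using sm T by (simp add: small_def)
  have e: "exp (2 * L * t) \<le> exp (2 * L * T)" using t L by (simp add: mult_left_mono)
  have "(1 + 2 * exp (2 * L * t)) * (\<eta> * T) \<le> K * (\<eta> * T)"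
    unfolding K_def using e c0 by (intro mult_right_mono) auto
  then have small: "(1 + 2 * exp (2 * L * t)) * (\<eta> * T) < \<rho> / 2" using sm by (simp add: small_def)
  have "norm (z s) \<le> 2 * (\<eta> * T) * exp (2 * L * t)"
    by (rule driven_bound[OF L _ zero stepwise_driven[OF _ z] _ small s])
      (use sm t in \<open>auto simp: small_def intro!: lip impulses_scaled_bound v simp del: norm_scaleR\<close>)
  also have "\<dots> \<le> (1 + 2 * exp (2 * L * t)) * (\<eta> * T)" using c0 by (simp add: algebra_simps)
  finally have *: "norm (z s) \<le> (1 + 2 * exp (2 * L * t)) * (\<eta> * T)" .
  also have "\<dots> \<le> K * (\<eta> * T)" by fact
  finally show "norm (z s) \<le> K * T * \<eta>" by (simp add: mult_ac)
  show "norm (z s) \<le> \<rho>" using * small \<rho> by simp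
qed

text \<open>\<open>F\<close> is controlled only on the ball. Composing it with the projection onto
  the ball, which is nonexpansive, gives a globally Lipschitz \<open>G\<close> whose approximations
  exist. The a priori bound keeps them where \<open>G\<close> and \<open>F\<close> agree.\<close>

lemma stepwise_ex:
  assumes sm: "small h \<eta>" and v: "\<And>n. 1 \<le> n \<Longrightarrow> norm (v n) \<le> 1"
  shows "\<exists>z. stepwise F V (h * \<eta>) 0 h T v z"
proof -
  let ?cp = "closest_point (cball (0::'a) \<rho>)"
  define G where "G s y = F s (?cp y)" for s y
  have ne: "cball (0::'a) \<rho> \<noteq> {}" using \<rho> by auto
  have cp: "?cp y \<in> cball 0 \<rho>" for y by (rule closest_point_in_set) (use ne in auto)
  have cpid: "y \<in> cball 0 \<rho> \<Longrightarrow> ?cp y = y" for y by (rule closest_point_self)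
  have h: "0 < h" and Lh: "L * h \<le> 1 / 2" and \<eta>: "0 \<le> \<eta>" and K\<eta>: "K * (\<eta> * T) < \<rho> / 2" and h\<eta>: "h * \<eta> \<le> \<rho> / 2"
    using sm by (auto simp: small_def)
  have lipG: "L-lipschitz_on UNIV (G s)" if s: "0 \<le> s" "s \<le> T" for s
  proof (rule lipschitz_onI)
    fix y z
    have "dist (G s y) (G s z) \<le> L * dist (?cp y) (?cp z)"
      unfolding G_def by (rule lipschitz_onD[OF lip[OF s] cp cp])
    also have "\<dots> \<le> L * dist y z"
      by (intro mult_left_mono closest_point_lipschitz L ne) auto
    finally show "dist (G s y) (G s z) \<le> L * dist y z" .
  qed (rule L)
  have contG: "continuous_on {a..b} (\<lambda>s. G s (y s))"
    if "0 \<le> a" "b \<le> T" "continuous_on {a..b} y" for a b y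
  proof -
    have "continuous_on {a..b} (\<lambda>s. (s, ?cp (y s)))"
      by (intro continuous_intros continuous_on_compose2[OF continuous_on_closest_point that(3)])
        (use ne in auto)
    then have "continuous_on {a..b} (\<lambda>s. case (s, ?cp (y s)) of (s, y) \<Rightarrow> F s y)"
      by (rule continuous_on_compose2[OF cont]) (use cp that in auto)
    then show ?thesis by (simp add: G_def)
  qed
  obtain z where z: "stepwise G UNIV (h * \<eta>) 0 h T v z"
    using stepwise_exist[OF h L Lh lipG contG] by blast
  have zb: "norm (z s) \<le> \<rho> / 2" if s: "0 \<le> s" "s \<le> T" for s
  proof -
    have "norm (z s) \<le> 2 * (\<eta> * T) * exp (2 * L * T)"
    proof (rule driven_bound[OF L _ _ stepwise_driven[OF h z] _ _ s])
      show "L-lipschitz_on (cball 0 \<rho>) (G s)" if "0 \<le> s" "s \<le> T" for s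
        using lipG[OF that] by (rule lipschitz_on_subset) simp
      show "G s 0 = 0" for s using cpid[of 0] zero \<rho> by (simp add: G_def)
      show "(1 + 2 * exp (2 * L * T)) * (\<eta> * T) < \<rho> / 2" using K\<eta> by (simp add: K_def)
    qed (use h \<eta> v in \<open>rule impulses_scaled_bound\<close>)
    also have "\<dots> \<le> K * (\<eta> * T)" using \<eta> T by (simp add: K_def algebra_simps)
    finally show ?thesis using K\<eta> by simp
  qed
  have "stepwise F V (h * \<eta>) 0 h T v z"
    unfolding stepwise_def
  proof (intro conjI allI impI)
    fix n assume n: "real n * h \<le> T"
    with z obtain \<phi> where \<phi>: "\<phi> (real n * h) = z (real n * h)"
      "ode_solution G UNIV {real n * h .. min (real (Suc n) * h) T} \<phi>"
      "\<forall>t. real n * h \<le> t \<and> t < real (Suc n) * h \<and> t \<le> T \<longrightarrow> z t = \<phi> t"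
      "real (Suc n) * h \<le> T \<longrightarrow> z (real (Suc n) * h) = \<phi> (real (Suc n) * h) + (h * \<eta>) *\<^sub>R v (Suc n)"
      unfolding stepwise_def by blast
    have n0: "0 \<le> real n * h" using h by simp
    \<comment> \<open>At the end of a step \<open>\<phi>\<close> takes the value before the jump,
      which \<open>z\<close> does not attain. It differs from \<open>z\<close> by at most
      \<open>h * \<eta> \<le> \<rho> / 2\<close>, which is why \<open>zb\<close> was established
      with half the radius.\<close>
    have \<phi>b: "\<phi> t \<in> cball 0 \<rho>" if t: "t \<in> {real n * h .. min (real (Suc n) * h) T}" for t
    proof (cases "t < real (Suc n) * h")
      case True
      then have "\<phi> t = z t" using \<phi>(3) t by auto
      then show ?thesis using zb[of t] t n0 \<rho> by auto
    next
      case False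
      then have t': "t = real (Suc n) * h" "t \<le> T" using t by auto
      then have "\<phi> t = z t - (h * \<eta>) *\<^sub>R v (Suc n)" using \<phi>(4) by simp
      also have "norm \<dots> \<le> norm (z t) + h * \<eta> * norm (v (Suc n))"
        using norm_triangle_ineq4[of "z t" "(h * \<eta>) *\<^sub>R v (Suc n)"] h \<eta> by simp
      also have "\<dots> \<le> \<rho> / 2 + h * \<eta> * 1"
        by (intro add_mono mult_left_mono zb v) (use t t' n0 h \<eta> in auto)
      finally show ?thesis using h\<eta> by simp
    qed
    have "ode_solution F V {real n * h .. min (real (Suc n) * h) T} \<phi>"
      using \<phi>(2) n0 unfolding ode_solution_def
      by (auto simp: G_def cpid[OF \<phi>b] intro!: sub \<phi>b)
    then show "\<exists>\<phi>. \<phi> (real n * h) = z (real n * h) \<and>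
         ode_solution F V {real n * h .. min (real (Suc n) * h) T} \<phi> \<and>
         (\<forall>t. real n * h \<le> t \<and> t < real (Suc n) * h \<and> t \<le> T \<longrightarrow> z t = \<phi> t) \<and>
         (real (Suc n) * h \<le> T \<longrightarrow>
            z (real (Suc n) * h) = \<phi> (real (Suc n) * h) + (h * \<eta>) *\<^sub>R v (Suc n))"
      using \<phi> by blast
  qed (use z in \<open>simp add: stepwise_def\<close>)
  then show ?thesis by blast
qed

text \<open>With equal amplitudes the two driving terms differ by \<eta> times the difference of the
  impulses, so the estimate stays proportional to \<eta>. The case \<open>c = 0\<close> gives
  uniqueness for given perturbations.\<close>

lemma stepwise_compare:
  assumes sm: "small h \<eta>" and v: "\<And>n. 1 \<le> n \<Longrightarrow> norm (v n) \<le> 1"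
    and sm': "small h' \<eta>" and v': "\<And>n. 1 \<le> n \<Longrightarrow> norm (v' n) \<le> 1"
    and z: "stepwise F V (h * \<eta>) 0 h t v z" and z': "stepwise F V (h' * \<eta>) 0 h' t v' z'"
    and t: "0 \<le> t" "t \<le> T"
    and c: "\<And>s. 0 \<le> s \<Longrightarrow> s \<le> t \<Longrightarrow> norm (impulses h v s - impulses h' v' s) \<le> c"
  shows "norm (z t - z' t) \<le> K * \<eta> * c"
proof -
  have h: "0 < h" "0 < h'" and \<eta>: "0 \<le> \<eta>" using sm sm' by (auto simp: small_def)
  have c0: "0 \<le> c" using order_trans[OF norm_ge_zero c[of t]] t by simp
  have "norm (z t - z' t) \<le> 2 * (\<eta> * c) * exp (2 * L * t)"
  proof (rule driven_compare[OF L _ stepwise_driven[OF h(1) z] stepwise_driven[OF h(2) z'] _ _ _ t(1)])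
    show "norm (\<eta> *\<^sub>R impulses h v s - \<eta> *\<^sub>R impulses h' v' s) \<le> \<eta> * c" if "0 \<le> s" "s \<le> t" for s
      using mult_left_mono[OF c[OF that] \<eta>] \<eta> by (simp flip: scaleR_diff_right)
    show "norm (z s) \<le> \<rho>" if "0 \<le> s" "s \<le> t" for s
      by (rule stepwise_bound(2)[OF sm v z t(2) that])
    show "norm (z' s) \<le> \<rho>" if "0 \<le> s" "s \<le> t" for s
      by (rule stepwise_bound(2)[OF sm' v' z' t(2) that])
  qed (use t lip in auto)
  also have "\<dots> \<le> 2 * (\<eta> * c) * exp (2 * L * T)"
    using \<eta> c0 L t by (intro mult_left_mono) (auto intro!: mult_left_mono)
  also have "\<dots> \<le> K * \<eta> * c" using \<eta> c0 by (simp add: K_def algebra_simps)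
  finally show ?thesis .
qed

text \<open>The increment splits into an integral, bounded through \<open>F r 0 = 0\<close> and the
  a priori bound, and an increment of the impulses, which causes the term \<open>h\<close>.\<close>

lemma stepwise_time_diff:
  assumes sm: "small h \<eta>" and v: "\<And>n. 1 \<le> n \<Longrightarrow> norm (v n) \<le> 1"
    and z: "stepwise F V (h * \<eta>) 0 h T v z"
    and ab: "0 \<le> a" "a \<le> b" "b \<le> T"
  shows "norm (z b - z a) \<le> \<eta> * (C * (b - a) + h)"
proof -
  have h: "0 < h" and \<eta>: "0 \<le> \<eta>" using sm by (auto simp: small_def)
  let ?w = "\<lambda>s. \<eta> *\<^sub>R impulses h v s"
  have I: "((\<lambda>r. F r (z r)) has_integral (z s - ?w s)) {0..s}" if "0 \<le> s" "s \<le> T" for s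
    using stepwise_driven[OF h z] that by (auto simp: driven_def)
  have int: "(\<lambda>r. F r (z r)) integrable_on {a..b}"
    using I[of b] ab by (auto intro!: integrable_on_subinterval)
  have "integral {0..a} (\<lambda>r. F r (z r)) + integral {a..b} (\<lambda>r. F r (z r)) = integral {0..b} (\<lambda>r. F r (z r))"
    by (rule Henstock_Kurzweil_Integration.integral_combine) (use I[of b] ab in auto)
  then have eq: "integral {a..b} (\<lambda>r. F r (z r)) = z b - z a - (?w b - ?w a)"
    using I[of a] I[of b] ab by (simp add: integral_unique algebra_simps)
  have "norm (integral {a..b} (\<lambda>r. F r (z r))) \<le> integral {a..b} (\<lambda>_. L * (K * T * \<eta>))"
  proof (rule integral_norm_bound_integral[OF int])
    fix r assume r: "r \<in> {a..b}"
    have "norm (F r (z r)) \<le> L * norm (z r)"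
      using lipschitz_onD[OF lip, of r "z r" 0] stepwise_bound(2)[OF sm v z, of r] r ab zero \<rho>
      by (simp add: dist_norm)
    also have "\<dots> \<le> L * (K * T * \<eta>)"
      using r ab by (intro mult_left_mono L stepwise_bound(1)[OF sm v z]) auto
    finally show "norm (F r (z r)) \<le> L * (K * T * \<eta>)" .
  qed auto
  also have "\<dots> = L * (K * T * \<eta>) * (b - a)" using ab by simp
  finally have "norm (z b - z a - (?w b - ?w a)) \<le> L * (K * T * \<eta>) * (b - a)" by (simp add: eq)
  moreover have "norm (?w b - ?w a) \<le> \<eta> * (b - a + h)"
    using mult_left_mono[OF impulses_diff[OF h v ab(1,2)] \<eta>] \<eta> by (simp flip: scaleR_diff_right)
  moreover have "norm (z b - z a) \<le> norm (z b - z a - (?w b - ?w a)) + norm (?w b - ?w a)"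
    using norm_triangle_ineq[of "z b - z a - (?w b - ?w a)" "?w b - ?w a"] by simp
  ultimately show ?thesis by (simp add: C_def algebra_simps)
qed

section \<open>Estimates for the supremum of the errors\<close>

text \<open>Over an empty family the extended supremum would be minus infinity; the unperturbed
  approximation shows that the family is not empty.\<close>

lemma zero_error_nonneg:
  assumes sm: "small h (\<gamma> h)" and t: "0 \<le> t" "t \<le> T"
  shows "0 \<le> zero_error F V \<gamma> t h"
proof -
  obtain z where "stepwise F V (h * \<gamma> h) 0 h T (\<lambda>_. 0) z"
    using stepwise_ex[OF sm, of "\<lambda>_. 0"] by auto
  then have "z \<in> approximations F V \<gamma> 0 h t"
    using stepwise_mono[OF _ t(2)] unfolding approximations_stepwise
    by (auto intro!: exI[of _ "\<lambda>_. 0"])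
  then show ?thesis unfolding zero_error_def by (rule SUP_upper2) simp
qed

lemma zero_error_le:
  assumes sm: "small h (\<gamma> h)" and t: "0 \<le> t" "t \<le> T"
  shows "zero_error F V \<gamma> t h \<le> ereal (K * T * \<gamma> h)"
  unfolding zero_error_def approximations_stepwise
  by (rule SUP_least) (use stepwise_bound(1)[OF sm] t in auto)

lemma zero_error_upper:
  assumes "stepwise F V (h * \<gamma> h) 0 h t v z" "\<And>n. 1 \<le> n \<Longrightarrow> norm (v n) \<le> 1"
  shows "ereal (norm (z t)) \<le> zero_error F V \<gamma> t h"
  unfolding zero_error_def approximations_stepwise by (rule SUP_upper) (use assms in auto)

text \<open>The members at time \<open>s\<close> are given only on \<open>{0..s}\<close>. Each is
  replaced by an approximation on \<open>{0..T}\<close> with the same perturbations, which has the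
  same value at \<open>s\<close> by uniqueness and can be compared with its value at
  \<open>t\<close>.\<close>

lemma zero_error_time:
  assumes sm: "small h (\<gamma> h)" and s: "0 \<le> s" "s \<le> T" and t: "0 \<le> t" "t \<le> T"
  shows "zero_error F V \<gamma> s h \<le> zero_error F V \<gamma> t h + ereal (\<gamma> h * (C * \<bar>s - t\<bar> + h))"
  unfolding zero_error_def[of F V \<gamma> s]
proof (rule SUP_least)
  fix y assume "y \<in> approximations F V \<gamma> 0 h s"
  then obtain v where v: "\<And>n. 1 \<le> n \<Longrightarrow> norm (v n) \<le> 1" and y: "stepwise F V (h * \<gamma> h) 0 h s v y"
    unfolding approximations_stepwise by auto
  obtain z where z: "stepwise F V (h * \<gamma> h) 0 h T v z" using stepwise_ex[OF sm, of v] v by blast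
  have "norm (y s - z s) \<le> K * \<gamma> h * 0"
    by (rule stepwise_compare[OF sm v sm v y stepwise_mono[OF z s(2)] s]) auto
  then have ys: "y s = z s" by simp
  have "norm (z s - z t) \<le> \<gamma> h * (C * \<bar>s - t\<bar> + h)"
  proof (cases "s \<le> t")
    case True
    then show ?thesis using stepwise_time_diff[OF sm v z, of s t] s t by (simp add: norm_minus_commute)
  qed (use stepwise_time_diff[OF sm v z, of t s] s t in simp)
  then have "norm (y s) \<le> norm (z t) + \<gamma> h * (C * \<bar>s - t\<bar> + h)"
    using norm_triangle_sub[of "z s" "z t"] by (simp add: ys)
  then have "ereal (norm (y s)) \<le> ereal (norm (z t)) + ereal (\<gamma> h * (C * \<bar>s - t\<bar> + h))" by simp
  also have "\<dots> \<le> zero_error F V \<gamma> t h + ereal (\<gamma> h * (C * \<bar>s - t\<bar> + h))"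
    by (intro add_right_mono zero_error_upper[where v = v]) (use stepwise_mono[OF z t(2)] v in auto)
  finally show "ereal (norm (y s)) \<le> zero_error F V \<gamma> t h + ereal (\<gamma> h * (C * \<bar>s - t\<bar> + h))" .
qed

text \<open>Matching \<open>\<beta> h' = \<gamma> h\<close> makes the amplitudes equal, so only the
  sampling of the perturbations changes, at a cost proportional to \<open>h + h'\<close>.\<close>

lemma change_of_scale:
  assumes sm: "small h (\<gamma> h)" and sm': "small h' (\<beta> h')" and eq: "\<beta> h' = \<gamma> h"
    and y: "y \<in> approximations F V \<gamma> 0 h T" and t: "0 \<le> t" "t \<le> T"
  shows "ereal (norm (y t)) \<le> zero_error F V \<beta> t h' + ereal (K * \<gamma> h * (h + h'))"
proof -
  obtain v where v: "\<And>n. 1 \<le> n \<Longrightarrow> norm (v n) \<le> 1" and y: "stepwise F V (h * \<gamma> h) 0 h T v y"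
    using y unfolding approximations_stepwise by auto
  have h: "0 < h" "0 < h'" using sm sm' by (auto simp: small_def)
  obtain v' where v': "\<And>n. 1 \<le> n \<Longrightarrow> norm (v' n) \<le> 1"
    and vv': "\<And>t. 0 \<le> t \<Longrightarrow> t \<le> T \<Longrightarrow> norm (impulses h v t - impulses h' v' t) \<le> h + h'"
    using impulses_resample[OF h, of v T] v by (metis atLeastAtMost_iff)
  obtain z where z: "stepwise F V (h' * \<beta> h') 0 h' T v' z" using stepwise_ex[OF sm', of v'] v' by blast
  have "norm (y t - z t) \<le> K * \<gamma> h * (h + h')"
    by (rule stepwise_compare[OF sm v sm'[unfolded eq] v' stepwise_mono[OF y t(2)]
        stepwise_mono[OF z[unfolded eq] t(2)] t]) (use vv' t in auto)
  then have "norm (y t) \<le> norm (z t) + K * \<gamma> h * (h + h')"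
    using norm_triangle_sub[of "y t" "z t"] by simp
  then have "ereal (norm (y t)) \<le> ereal (norm (z t)) + ereal (K * \<gamma> h * (h + h'))" by simp
  also have "\<dots> \<le> zero_error F V \<beta> t h' + ereal (K * \<gamma> h * (h + h'))"
    by (intro add_right_mono zero_error_upper[where v = v']) (use stepwise_mono[OF z t(2)] v' in auto)
  finally show ?thesis .
qed

lemma small_eventually:
  assumes "admissible_scale \<gamma>"
  shows "eventually (\<lambda>h. small h (\<gamma> h)) (at_right 0)"
proof -
  note lim = admissible_scale_tendsto[OF assms]
  have "((\<lambda>h. L * h) \<longlongrightarrow> L * 0) (at_right 0)" by (intro tendsto_intros)
  then have 1: "eventually (\<lambda>h. L * h < 1 / 2) (at_right 0)" by (rule order_tendstoD) simp
  have "((\<lambda>h. K * (\<gamma> h * T)) \<longlongrightarrow> K * (0 * T)) (at_right 0)" by (intro tendsto_intros lim)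
  then have 2: "eventually (\<lambda>h. K * (\<gamma> h * T) < \<rho> / 2) (at_right 0)"
    by (rule order_tendstoD) (use \<rho> in simp)
  have "((\<lambda>h. h * \<gamma> h) \<longlongrightarrow> 0 * 0) (at_right 0)" by (intro tendsto_intros lim)
  then have 3: "eventually (\<lambda>h. h * \<gamma> h < \<rho> / 2) (at_right 0)"
    by (rule order_tendstoD) (use \<rho> in simp)
  have 4: "eventually (\<lambda>h. 0 < h) (at_right (0::real))" by (rule eventually_at_right_less)
  show ?thesis
    using 1 2 3 4
    by eventually_elim (use admissible_scale_pos[OF assms] in \<open>simp add: small_def less_imp_le\<close>)
qed

end

section \<open>From pointwise to uniform upper limits\<close>

text \<open>An argument of Ascoli type: the functions \<open>R t h\<close> share a modulus of
  continuity in \<open>t\<close> up to the vanishing term \<open>h\<close>, and \<open>E\<close>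
  inherits it. The pointwise bounds at a finite net of times therefore extend to the whole
  interval.\<close>

lemma uniform_Limsup:
  fixes R :: "real \<Rightarrow> real \<Rightarrow> real" and B C T :: real
  defines "E \<equiv> \<lambda>t. Limsup (at_right 0) (\<lambda>h. ereal (R t h))"
  assumes C: "0 < C"
    and bnd: "\<forall>\<^sub>F h in at_right 0. \<forall>t\<in>{0..T}. 0 \<le> R t h \<and> R t h \<le> B"
    and equi: "\<forall>\<^sub>F h in at_right 0. \<forall>s\<in>{0..T}. \<forall>t\<in>{0..T}. R s h \<le> R t h + C * \<bar>s - t\<bar> + h"
    and \<epsilon>: "0 < \<epsilon>"
  shows "\<forall>t\<in>{0..T}. 0 \<le> E t \<and> E t \<le> ereal B"
    and "\<forall>\<^sub>F h in at_right 0. \<forall>t\<in>{0..T}. ereal (R t h) \<le> E t + ereal \<epsilon>"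
proof -
  have nb: "at_right (0::real) \<noteq> bot" by simp
  have E_fin: "0 \<le> E t \<and> E t \<le> ereal B" if "t \<in> {0..T}" for t
  proof
    show "0 \<le> E t"
      unfolding E_def by (rule le_Limsup[OF nb]) (use bnd that in \<open>auto elim!: eventually_mono\<close>)
    show "E t \<le> ereal B"
      unfolding E_def by (rule Limsup_bounded) (use bnd that in \<open>auto elim!: eventually_mono\<close>)
  qed
  then show "\<forall>t\<in>{0..T}. 0 \<le> E t \<and> E t \<le> ereal B" by blast
  have small: "\<forall>\<^sub>F h in at_right (0::real). h < \<epsilon> / 8"
    by (rule eventually_at_right_real[of 0 "\<epsilon> / 8", THEN eventually_mono]) (use \<epsilon> in auto)
  \<comment> \<open>Then \<open>C * d = \<epsilon> / 8\<close>, and together with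
    \<open>h < \<epsilon> / 8\<close> moving to a net point costs \<epsilon>/4. In total the costs
    are \<epsilon>/4 for \<open>R\<close>, \<epsilon>/8 at the net point and \<epsilon>/4 for
    \<open>E\<close>, which is less than \<epsilon>.\<close>
  define d where "d = \<epsilon> / (8 * C)"
  have d: "0 < d" using C \<epsilon> by (simp add: d_def)
  have Cd: "C * \<bar>s - t\<bar> \<le> \<epsilon> / 8" if "\<bar>s - t\<bar> < d" for s t
    using mult_left_mono[of "\<bar>s - t\<bar>" d C] that C by (simp add: d_def)
  have E_equi: "E s \<le> E t + ereal (\<epsilon> / 4)" if st: "s \<in> {0..T}" "t \<in> {0..T}" "\<bar>s - t\<bar> < d" for s t
  proof -
    have "\<forall>\<^sub>F h in at_right 0. ereal (R s h) \<le> ereal (R t h) + ereal (\<epsilon> / 4)"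
      using equi small
    proof eventually_elim
      case (elim h)
      then have "R s h \<le> R t h + C * \<bar>s - t\<bar> + h" using st by blast
      then show ?case using Cd[OF st(3)] elim(2) by simp
    qed
    then have "E s \<le> Limsup (at_right 0) (\<lambda>h. ereal (R t h) + ereal (\<epsilon> / 4))"
      unfolding E_def by (rule Limsup_mono)
    also have "\<dots> = E t + ereal (\<epsilon> / 4)"
      unfolding E_def by (rule Limsup_add_ereal_right) auto
    finally show ?thesis .
  qed
  have "{0..T} \<subseteq> (\<Union>s\<in>{0..T}. ball s d)" using d by force
  then obtain D where D: "D \<subseteq> {0..T}" "finite D" "{0..T} \<subseteq> (\<Union>s\<in>D. ball s d)"
    by (rule compactE_image[OF compact_Icc, rotated]) auto
  have "\<forall>s\<in>D. \<forall>\<^sub>F h in at_right 0. ereal (R s h) < E s + ereal (\<epsilon> / 8)"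
  proof
    fix s assume "s \<in> D"
    \<comment> \<open>Finiteness makes \<open>E s + \<epsilon> / 8\<close> strictly larger than
      \<open>E s\<close>, as the defining property of the upper limit demands.\<close>
    then have "\<bar>E s\<bar> \<noteq> \<infinity>" using E_fin[of s] D by (cases "E s") auto
    then have "E s < E s + ereal (\<epsilon> / 8)" using \<epsilon> by (cases "E s") auto
    then show "\<forall>\<^sub>F h in at_right 0. ereal (R s h) < E s + ereal (\<epsilon> / 8)"
      unfolding E_def by (rule Limsup_lessD)
  qed
  then have "\<forall>\<^sub>F h in at_right 0. \<forall>s\<in>D. ereal (R s h) < E s + ereal (\<epsilon> / 8)"
    using D(2) by (simp add: eventually_ball_finite)
  then show "\<forall>\<^sub>F h in at_right 0. \<forall>t\<in>{0..T}. ereal (R t h) \<le> E t + ereal \<epsilon>"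
    using equi small
  proof eventually_elim
    case (elim h)
    show ?case
    proof
      fix t assume t: "t \<in> {0..T}"
      then obtain s where s: "s \<in> D" "\<bar>s - t\<bar> < d" using D(3) by (auto simp: dist_real_def)
      then have sT: "s \<in> {0..T}" using D by blast
      have "R t h \<le> R s h + C * \<bar>t - s\<bar> + h" using elim(2) sT t by blast
      then have "R t h \<le> R s h + \<epsilon> / 4" using Cd[of t s] s elim(3) by (simp add: abs_minus_commute)
      moreover have "ereal (R s h) < E s + ereal (\<epsilon> / 8)" using elim(1) s by blast
      moreover note E_equi[OF sT t s(2)] E_fin[OF sT] E_fin[OF t]
      ultimately show "ereal (R t h) \<le> E t + ereal \<epsilon>"
        using \<epsilon> by (cases "E s"; cases "E t") auto
    qed
  qed
qed

section \<open>The uniform error bound in the tube\<close>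

context tube
begin

lemma zero_growth_uniform:
  assumes \<beta>: "admissible_scale \<beta>" and \<epsilon>: "0 < \<epsilon>"
  shows "\<forall>t\<in>{0..T}. 0 \<le> zero_growth F V \<beta> t \<and> zero_growth F V \<beta> t < \<infinity>"
    and "\<forall>\<^sub>F h in at_right 0. \<forall>t\<in>{0..T}.
      zero_error F V \<beta> t h \<le> (zero_growth F V \<beta> t + ereal \<epsilon>) * ereal (\<beta> h)"
proof -
  \<comment> \<open>\<open>real_of_ereal\<close> sends infinite values to 0, but for small
    \<open>h\<close> the error lies between 0 and \<open>K * T * \<beta> h\<close>, so
    \<open>R\<close> is the true quotient there. The upper limit sees only such
    \<open>h\<close>.\<close>
  define R where "R t h = real_of_ereal (zero_error F V \<beta> t h) / \<beta> h" for t h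
  have sm: "\<forall>\<^sub>F h in at_right 0. 0 < h \<and> 0 < \<beta> h \<and> small h (\<beta> h)"
    using small_eventually[OF \<beta>] eventually_at_right_less
    by eventually_elim (use admissible_scale_pos[OF \<beta>] in auto)
  have R: "zero_error F V \<beta> t h = ereal (R t h * \<beta> h)" "0 \<le> R t h" "R t h \<le> K * T"
    if h: "0 < \<beta> h" "small h (\<beta> h)" and t: "t \<in> {0..T}" for t h
  proof -
    have "0 \<le> zero_error F V \<beta> t h" "zero_error F V \<beta> t h \<le> ereal (K * T * \<beta> h)"
      using zero_error_nonneg[of h \<beta> t] zero_error_le[of h \<beta> t] h t by auto
    then obtain e where e: "zero_error F V \<beta> t h = ereal e" "0 \<le> e" "e \<le> K * T * \<beta> h"
      by (cases "zero_error F V \<beta> t h") auto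
    then show "zero_error F V \<beta> t h = ereal (R t h * \<beta> h)" "0 \<le> R t h" "R t h \<le> K * T"
      using h by (auto simp: R_def pos_divide_le_eq)
  qed
  have growth: "zero_growth F V \<beta> t = Limsup (at_right 0) (\<lambda>h. ereal (R t h))" if t: "t \<in> {0..T}" for t
    unfolding zero_growth_def
    by (rule Limsup_eq, use sm in eventually_elim) (use R(1)[OF _ _ t] in auto)
  have bnd: "\<forall>\<^sub>F h in at_right 0. \<forall>t\<in>{0..T}. 0 \<le> R t h \<and> R t h \<le> K * T"
    using sm by eventually_elim (use R in auto)
  have equi: "\<forall>\<^sub>F h in at_right 0. \<forall>s\<in>{0..T}. \<forall>t\<in>{0..T}. R s h \<le> R t h + C * \<bar>s - t\<bar> + h"
    using sm
  proof eventually_elim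
    case (elim h)
    show ?case
    proof (intro ballI)
      fix s t assume st: "s \<in> {0..T}" "t \<in> {0..T}"
      have "R s h * \<beta> h \<le> R t h * \<beta> h + \<beta> h * (C * \<bar>s - t\<bar> + h)"
        using zero_error_time[of h \<beta> s t] elim st by (simp add: R)
      also have "\<dots> = (R t h + C * \<bar>s - t\<bar> + h) * \<beta> h" by (simp add: algebra_simps)
      finally show "R s h \<le> R t h + C * \<bar>s - t\<bar> + h" using elim by simp
    qed
  qed
  note u = uniform_Limsup[OF C_pos bnd equi \<epsilon>]
  show "\<forall>t\<in>{0..T}. 0 \<le> zero_growth F V \<beta> t \<and> zero_growth F V \<beta> t < \<infinity>"
    using u(1) by (auto simp: growth intro: le_less_trans)
  show "\<forall>\<^sub>F h in at_right 0. \<forall>t\<in>{0..T}.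
      zero_error F V \<beta> t h \<le> (zero_growth F V \<beta> t + ereal \<epsilon>) * ereal (\<beta> h)"
    using u(2) sm
  proof eventually_elim
    case (elim h)
    show ?case
    proof
      fix t assume t: "t \<in> {0..T}"
      have "ereal (R t h) * ereal (\<beta> h) \<le> (zero_growth F V \<beta> t + ereal \<epsilon>) * ereal (\<beta> h)"
        using elim t by (intro ereal_mult_right_mono) (auto simp: growth)
      then show "zero_error F V \<beta> t h \<le> (zero_growth F V \<beta> t + ereal \<epsilon>) * ereal (\<beta> h)"
        using elim t by (simp add: R)
    qed
  qed
qed

text \<open>Of the margin \<epsilon>, one half goes to the uniform upper limit for
  \<open>\<beta>\<close>, a quarter to the change of scale, and the rest makes the inequality
  strict.\<close>

lemma approximation_error:
  assumes \<alpha>: "admissible_scale \<alpha>" and \<beta>: "admissible_scale \<beta>" and \<epsilon>: "0 < \<epsilon>"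
  shows "\<forall>\<^sub>F h in at_right 0. \<forall>y\<in>approximations F V \<alpha> 0 h T. \<forall>t\<in>{0..T}.
    ereal (norm (y t)) < (zero_growth F V \<beta> t + ereal \<epsilon>) * ereal (\<alpha> h)"
proof -
  have "\<forall>\<^sub>F h in at_right 0. small h (\<beta> h) \<and> (\<forall>t\<in>{0..T}.
      zero_error F V \<beta> t h \<le> (zero_growth F V \<beta> t + ereal (\<epsilon> / 2)) * ereal (\<beta> h))"
    using small_eventually[OF \<beta>] zero_growth_uniform(2)[OF \<beta>, of "\<epsilon> / 2"] \<epsilon>
    by (simp add: eventually_conj_iff)
  then obtain d where d: "0 < d" and dd: "\<And>h. 0 < h \<Longrightarrow> h < d \<Longrightarrow> small h (\<beta> h)"
    "\<And>h t. 0 < h \<Longrightarrow> h < d \<Longrightarrow> t \<in> {0..T} \<Longrightarrow>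
      zero_error F V \<beta> t h \<le> (zero_growth F V \<beta> t + ereal (\<epsilon> / 2)) * ereal (\<beta> h)"
    unfolding eventually_at_right_field by auto
  \<comment> \<open>Halving \<open>d\<close> keeps \<open>h' \<le> d'\<close> strictly below
    \<open>d\<close>. The second bound, imposed on \<open>h\<close> as well, gives
    \<open>K * (h + h') \<le> \<epsilon> / 4\<close>.\<close>
  define d' where "d' = min (d / 2) (\<epsilon> / (8 * K))"
  have d': "0 < d'" "d' < d" using d \<epsilon> K_pos by (auto simp: d'_def)
  have \<beta>': "continuous_on {0..} \<beta>" "\<beta> 0 = 0"
    using \<beta> by (auto simp: admissible_scale_def)
  have "0 < \<beta> d'" using \<beta> d'(1) by (rule admissible_scale_pos)
  moreover note admissible_scale_tendsto[OF \<alpha>]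
  ultimately have "\<forall>\<^sub>F h in at_right 0. \<alpha> h < \<beta> d'"
    by (rule order_tendstoD(2)[rotated])
  moreover have "\<forall>\<^sub>F h in at_right (0::real). h < \<epsilon> / (8 * K)"
    by (rule eventually_at_right_real[of 0 "\<epsilon> / (8 * K)", THEN eventually_mono]) (use \<epsilon> K_pos in auto)
  moreover note small_eventually[OF \<alpha>] eventually_at_right_less[of "0::real"]
  ultimately show ?thesis
  proof eventually_elim
    case (elim h)
    have \<alpha>h: "0 < \<alpha> h" using \<alpha> elim(4) by (rule admissible_scale_pos)
    \<comment> \<open>\<open>\<beta>\<close> runs continuously from 0 to \<open>\<beta> d'\<close>,
      which exceeds \<open>\<alpha> h\<close>, so it takes that value; positivity of
      \<open>\<alpha> h\<close> then excludes \<open>h' = 0\<close>.\<close>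
    have "\<exists>h'\<ge>0. h' \<le> d' \<and> \<beta> h' = \<alpha> h"
      by (rule IVT') (use \<alpha>h \<beta>'(2) elim d' in \<open>auto intro: continuous_on_subset[OF \<beta>'(1)]\<close>)
    then obtain h' where h': "0 \<le> h'" "h' \<le> d'" "\<beta> h' = \<alpha> h" by blast
    then have "h' \<noteq> 0" using \<alpha>h \<beta>'(2) by auto
    with h' d' have h'd: "0 < h'" "h' < d" by auto
    have "K * (h + h') \<le> K * (\<epsilon> / (8 * K) + \<epsilon> / (8 * K))"
      using elim h' K_pos by (intro mult_left_mono add_mono) (auto simp: d'_def)
    also have "\<dots> = \<epsilon> / 4" using K_pos by (simp add: field_simps)
    finally have Kh: "K * (h + h') \<le> \<epsilon> / 4" .
    show ?case
    proof (intro ballI)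
      fix y t assume y: "y \<in> approximations F V \<alpha> 0 h T" and t: "t \<in> {0..T}"
      have "0 \<le> zero_growth F V \<beta> t" "zero_growth F V \<beta> t < \<infinity>"
        using zero_growth_uniform(1)[OF \<beta> \<epsilon>] t by auto
      then obtain E where E: "zero_growth F V \<beta> t = ereal E"
        by (cases "zero_growth F V \<beta> t") auto
      have "ereal (norm (y t)) \<le> zero_error F V \<beta> t h' + ereal (K * \<alpha> h * (h + h'))"
        by (rule change_of_scale[where \<gamma> = \<alpha> and h = h])
          (use elim(3) dd(1)[OF h'd] h'(3) y t in auto)
      also have "\<dots> \<le> (ereal E + ereal (\<epsilon> / 2)) * ereal (\<alpha> h) + ereal (K * \<alpha> h * (h + h'))"
        using dd(2)[OF h'd t] by (intro add_right_mono) (simp add: E h'(3))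
      also have "\<dots> = ereal ((E + \<epsilon> / 2 + K * (h + h')) * \<alpha> h)" by (simp add: algebra_simps)
      also have "\<dots> < ereal ((E + \<epsilon>) * \<alpha> h)"
        using Kh \<epsilon> \<alpha>h by (auto intro!: mult_strict_right_mono)
      finally show "ereal (norm (y t)) < (zero_growth F V \<beta> t + ereal \<epsilon>) * ereal (\<alpha> h)"
        by (simp add: E)
    qed
  qed
qed

end

section \<open>Reduction to the deviation from the solution\<close>

text \<open>The passage from \<open>(t, x)\<close> to \<open>(s, y)\<close> goes through
  \<open>(s, x)\<close>: first continuity in time at fixed \<open>x\<close>, then the Lipschitz
  estimate, whose constant is the same for all nearby times. Relative openness of \<open>U\<close>
  puts \<open>(s, x)\<close> into \<open>U\<close>.\<close>

lemma jointly_continuous: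
  fixes f :: "real \<Rightarrow> 'a::real_normed_vector \<Rightarrow> 'a"
  assumes U: "openin (top_of_set ({0..} \<times> UNIV)) U"
    and ct: "continuous_in_time f U" and ll: "locally_lipschitz_in_state f U"
  shows "continuous_on U (\<lambda>(t, x). f t x)"
  unfolding continuous_on_iff
proof (clarify)
  fix t x and e :: real assume tx: "(t, x) \<in> U" and e: "0 < e"
  obtain r L where r: "0 < r" and lip: "\<And>s. s \<in> cball t r \<Longrightarrow> L-lipschitz_on {y \<in> cball x r. (s, y) \<in> U} (f s)"
    using ll tx unfolding locally_lipschitz_in_state_def by blast
  have L: "0 \<le> L" using lip[of t] r lipschitz_on_nonneg by auto
  obtain d1 where d1: "0 < d1" "\<And>p. p \<in> {0..} \<times> UNIV \<Longrightarrow> dist p (t, x) < d1 \<Longrightarrow> p \<in> U"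
    using U tx unfolding openin_euclidean_subtopology_iff by blast
  have U0: "s \<ge> 0" if "(s, y) \<in> U" for s y using openin_imp_subset[OF U] that by auto
  have "continuous_on {t. (t, x) \<in> U} (\<lambda>t. f t x)" using ct by (auto simp: continuous_in_time_def)
  then obtain d2 where d2: "0 < d2" "\<And>s. (s, x) \<in> U \<Longrightarrow> dist s t < d2 \<Longrightarrow> dist (f s x) (f t x) < e / 2"
    using tx half_gt_zero[OF e] unfolding continuous_on_iff by blast
  \<comment> \<open>The denominator uses \<open>L + 1\<close> because \<open>L\<close> may be
    0.\<close>
  define d where "d = Min {r, d1, d2, e / (2 * (L + 1))}"
  have d: "0 < d" "d \<le> r" "d \<le> d1" "d \<le> d2" "d \<le> e / (2 * (L + 1))"
    using r d1(1) d2(1) e L by (auto simp: d_def)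
  show "\<exists>d>0. \<forall>p'\<in>U. dist p' (t, x) < d \<longrightarrow> dist (case p' of (t, x) \<Rightarrow> f t x) (f t x) < e"
  proof (intro exI[of _ d] conjI ballI impI)
    fix p' assume p': "p' \<in> U" "dist p' (t, x) < d"
    obtain s y where sy: "p' = (s, y)" by fastforce
    have ds: "dist s t < d" "dist y x < d"
      using p' dist_fst_le[of p' "(t, x)"] dist_snd_le[of p' "(t, x)"] by (auto simp: sy)
    have sx: "(s, x) \<in> U"
      by (rule d1(2)) (use ds d U0 p' sy in \<open>auto simp: dist_Pair_Pair\<close>)
    have "dist (f s y) (f s x) \<le> L * dist y x"
      by (rule lipschitz_onD[OF lip]) (use ds d sx p' sy r in \<open>auto simp: dist_commute\<close>)
    also have "\<dots> \<le> L * (e / (2 * (L + 1)))"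
      using ds d L by (intro mult_left_mono) auto
    also have "\<dots> \<le> e / 2" using L e by (simp add: field_simps)
    finally have "dist (f s y) (f s x) \<le> e / 2" .
    moreover have "dist (f s x) (f t x) < e / 2" using d2(2)[OF sx] ds d by simp
    ultimately show "dist (case p' of (t, x) \<Rightarrow> f t x) (f t x) < e"
      using dist_triangle[of "f s y" "f t x" "f s x"] by (simp add: sy)
  qed (use d in auto)
qed

text \<open>Each time has a neighbourhood with its own radius and Lipschitz constant. By compactness
  finitely many cover \<open>{0..T}\<close>, and the smallest radius and the largest constant work
  throughout.\<close>

lemma tube_around_solution:
  fixes f :: "real \<Rightarrow> 'a::euclidean_space \<Rightarrow> 'a"
  assumes U: "openin (top_of_set ({0..} \<times> UNIV)) U"
    and ct: "continuous_in_time f U" and ll: "locally_lipschitz_in_state f U"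
    and x: "ode_solution f U {0..} x" and T: "0 < T"
  shows "\<exists>L \<rho>. tube (\<lambda>t y. f t (y + x t) - f t (x t)) {(t, y). (t, y + x t) \<in> U} L \<rho> T"
proof -
  let ?F = "\<lambda>t y. f t (y + x t) - f t (x t)"
  have xU: "(s, x s) \<in> U" if "0 \<le> s" for s using x that by (auto simp: ode_solution_def)
  have contx: "continuous_on {0..} x"
    unfolding continuous_on_eq_continuous_within
    using x has_vector_derivative_continuous by (fastforce simp: ode_solution_def)
  have "\<forall>s\<in>{0..T}. \<exists>r L. 0 < r \<and> (\<forall>s'\<in>ball s r. 0 \<le> s' \<longrightarrow>
      (\<forall>y\<in>cball 0 r. (s', y + x s') \<in> U) \<and> L-lipschitz_on (cball 0 r) (?F s'))"
  proof
    fix s assume s: "s \<in> {0..T}"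
    then have sx: "(s, x s) \<in> U" using xU by auto
    obtain r L where r: "0 < r"
      and lip: "\<And>s'. s' \<in> cball s r \<Longrightarrow> L-lipschitz_on {y \<in> cball (x s) r. (s', y) \<in> U} (f s')"
      using ll sx unfolding locally_lipschitz_in_state_def by blast
    obtain e where e: "0 < e" "\<And>p. p \<in> {0..} \<times> UNIV \<Longrightarrow> dist p (s, x s) < e \<Longrightarrow> p \<in> U"
      using U sx unfolding openin_euclidean_subtopology_iff by blast
    \<comment> \<open>For \<open>s'\<close> within \<open>q\<close> of \<open>s\<close> and
      \<open>y\<close> of norm at most \<open>q\<close>, the state \<open>y + x s'\<close> is within
      \<open>q + m \<le> r\<close> of \<open>x s\<close>, and the point in space-time is within
      \<open>2 * q + m < e\<close> of \<open>(s, x s)\<close>.\<close>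
    define m where "m = min (e / 4) (r / 2)"
    have m: "0 < m" using e r by (simp add: m_def)
    obtain d where d: "0 < d" "\<And>s'. 0 \<le> s' \<Longrightarrow> dist s' s < d \<Longrightarrow> dist (x s') (x s) < m"
      using contx s m unfolding continuous_on_iff by fastforce
    define q where "q = min m d"
    have q: "0 < q" "q \<le> e / 4" "q \<le> r / 2" "q \<le> d" using m d by (auto simp: q_def m_def)
    show "\<exists>r L. 0 < r \<and> (\<forall>s'\<in>ball s r. 0 \<le> s' \<longrightarrow>
      (\<forall>y\<in>cball 0 r. (s', y + x s') \<in> U) \<and> L-lipschitz_on (cball 0 r) (?F s'))"
    proof (rule exI[of _ q], rule exI[of _ L], intro conjI ballI impI)
      fix s' assume s': "s' \<in> ball s q" "0 \<le> s'"
      have xs: "dist (x s') (x s) < m" using d(2)[of s'] s' q by (auto simp: dist_commute)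
      have near: "dist (y + x s') (x s) \<le> q + m" if "y \<in> cball 0 q" for y
      proof -
        have "dist (y + x s') (x s) \<le> norm y + norm (x s' - x s)"
          using norm_triangle_ineq[of y "x s' - x s"] by (simp add: dist_norm algebra_simps)
        then show ?thesis using that xs by (simp add: dist_norm)
      qed
      have inU: "(s', y + x s') \<in> U" if "y \<in> cball 0 q" for y
      proof (rule e(2))
        have "dist (s', y + x s') (s, x s) \<le> dist s' s + dist (y + x s') (x s)"
          unfolding dist_Pair_Pair by (rule sqrt_sum_squares_le_sum) auto
        also have "\<dots> < e" using near[OF that] s' q e(1) by (auto simp: m_def dist_commute)
        finally show "dist (s', y + x s') (s, x s) < e" .
      qed (use s' in auto)
      then show "(s', y + x s') \<in> U" if "y \<in> cball 0 q" for y using that .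
      have L: "L-lipschitz_on {y \<in> cball (x s) r. (s', y) \<in> U} (f s')"
        by (rule lip) (use s' q r in auto)
      show "L-lipschitz_on (cball 0 q) (?F s')"
      proof (rule lipschitz_onI)
        show "0 \<le> L" by (rule lipschitz_on_nonneg[OF L])
        fix y z :: 'a assume yz: "y \<in> cball 0 q" "z \<in> cball 0 q"
        have "dist (f s' (y + x s')) (f s' (z + x s')) \<le> L * dist (y + x s') (z + x s')"
          by (rule lipschitz_onD[OF L])
            (use near[OF yz(1)] near[OF yz(2)] inU yz q in \<open>auto simp: m_def dist_commute\<close>)
        then show "dist (?F s' y) (?F s' z) \<le> L * dist y z" by (simp add: dist_norm)
      qed
    qed (use q in auto)
  qed
  then obtain r L where r: "\<And>s. s \<in> {0..T} \<Longrightarrow> 0 < r s"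
    and rU: "\<And>s s' y. s \<in> {0..T} \<Longrightarrow> s' \<in> ball s (r s) \<Longrightarrow> 0 \<le> s' \<Longrightarrow> y \<in> cball 0 (r s) \<Longrightarrow> (s', y + x s') \<in> U"
    and rL: "\<And>s s'. s \<in> {0..T} \<Longrightarrow> s' \<in> ball s (r s) \<Longrightarrow> 0 \<le> s' \<Longrightarrow> (L s)-lipschitz_on (cball 0 (r s)) (?F s')"
    by metis
  have "{0..T} \<subseteq> (\<Union>s\<in>{0..T}. ball s (r s))" using r by force
  then obtain D where D: "D \<subseteq> {0..T}" "finite D" "{0..T} \<subseteq> (\<Union>s\<in>D. ball s (r s))"
    by (rule compactE_image[OF compact_Icc, rotated]) auto
  have Dne: "D \<noteq> {}" using D(3) T by auto
  define \<rho> where "\<rho> = Min (r ` D)"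
  define M where "M = Max (L ` D)"
  have \<rho>le: "\<rho> \<le> r s" and Mge: "L s \<le> M" if "s \<in> D" for s
    using that D by (auto simp: \<rho>_def M_def)
  have \<rho>: "0 < \<rho>" using D Dne r by (auto simp: \<rho>_def)
  have local: "(\<forall>y\<in>cball 0 \<rho>. (s, y + x s) \<in> U) \<and> M-lipschitz_on (cball 0 \<rho>) (?F s)"
    if s: "0 \<le> s" "s \<le> T" for s
  proof -
    obtain s0 where s0: "s0 \<in> D" "s \<in> ball s0 (r s0)" using D(3) s by auto
    then have s0T: "s0 \<in> {0..T}" using D by auto
    have sub: "cball (0::'a) \<rho> \<subseteq> cball 0 (r s0)" using \<rho>le[OF s0(1)] by auto
    show ?thesis
      using rU[OF s0T s0(2) s(1)] sub
        lipschitz_on_mono[OF rL[OF s0T s0(2) s(1)] sub Mge[OF s0(1)]] by blast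
  qed
  have M: "0 \<le> M" using local[of 0] T lipschitz_on_nonneg by auto
  have c1: "continuous_on ({0..T} \<times> cball 0 \<rho>) (\<lambda>p. (\<lambda>(t, x). f t x) (fst p, snd p + x (fst p)))"
    by (rule continuous_on_compose2[OF jointly_continuous[OF U ct ll]])
      (use local in \<open>auto intro!: continuous_intros continuous_on_compose2[OF contx]\<close>)
  have c2: "continuous_on ({0..T} \<times> cball 0 \<rho>) (\<lambda>p. (\<lambda>(t, x). f t x) (fst p, x (fst p)))"
    by (rule continuous_on_compose2[OF jointly_continuous[OF U ct ll]])
      (use xU in \<open>auto intro!: continuous_intros continuous_on_compose2[OF contx]\<close>)
  have "continuous_on ({0..T} \<times> cball 0 \<rho>) (\<lambda>(s, y). ?F s y)"
    using continuous_on_diff[OF c1 c2] by (simp add: case_prod_unfold)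
  then show ?thesis
    using M \<rho> T local by (intro exI[of _ M] exI[of _ \<rho>], unfold_locales) auto
qed

text \<open>The exact solution \<open>x\<close> runs through all steps without jumps. Subtracting it
  from the solution on each step therefore leaves the perturbations unchanged and yields a solution
  of the deviation equation.\<close>

lemma approximations_deviation:
  assumes x: "ode_solution f U {0..} x" and h: "0 < h"
    and z: "z \<in> approximations f U \<alpha> (x 0) h T"
  shows "(\<lambda>t. z t - x t) \<in>
    approximations (\<lambda>t y. f t (y + x t) - f t (x t)) {(t, y). (t, y + x t) \<in> U} \<alpha> 0 h T"
proof -
  let ?F = "\<lambda>t y. f t (y + x t) - f t (x t)" and ?V = "{(t, y). (t, y + x t) \<in> U}"
  obtain v where v: "\<forall>n\<ge>1. norm (v n) \<le> 1" and z: "stepwise f U (h * \<alpha> h) (x 0) h T v z"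
    using z unfolding approximations_stepwise by blast
  have "stepwise ?F ?V (h * \<alpha> h) 0 h T v (\<lambda>t. z t - x t)"
    unfolding stepwise_def
  proof (intro conjI allI impI)
    fix n assume n: "real n * h \<le> T"
    with z obtain \<phi> where \<phi>: "\<phi> (real n * h) = z (real n * h)"
      "ode_solution f U {real n * h .. min (real (Suc n) * h) T} \<phi>"
      "\<forall>t. real n * h \<le> t \<and> t < real (Suc n) * h \<and> t \<le> T \<longrightarrow> z t = \<phi> t"
      "real (Suc n) * h \<le> T \<longrightarrow> z (real (Suc n) * h) = \<phi> (real (Suc n) * h) + (h * \<alpha> h) *\<^sub>R v (Suc n)"
      unfolding stepwise_def by blast
    have "ode_solution f U {real n * h .. min (real (Suc n) * h) T} x"
      by (rule ode_solution_subset[OF x]) (use mult_nonneg_nonneg[of "real n" h] h in auto)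
    then have "ode_solution ?F ?V {real n * h .. min (real (Suc n) * h) T} (\<lambda>t. \<phi> t - x t)"
      using \<phi>(2) unfolding ode_solution_def by (simp add: has_vector_derivative_diff)
    then show "\<exists>\<phi>. \<phi> (real n * h) = z (real n * h) - x (real n * h) \<and>
         ode_solution ?F ?V {real n * h .. min (real (Suc n) * h) T} \<phi> \<and>
         (\<forall>t. real n * h \<le> t \<and> t < real (Suc n) * h \<and> t \<le> T \<longrightarrow> z t - x t = \<phi> t) \<and>
         (real (Suc n) * h \<le> T \<longrightarrow> z (real (Suc n) * h) - x (real (Suc n) * h)
            = \<phi> (real (Suc n) * h) + (h * \<alpha> h) *\<^sub>R v (Suc n))"
      using \<phi>(1,3,4) by (intro exI[of _ "\<lambda>t. \<phi> t - x t"] conjI) simp_all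
  qed (use z in \<open>simp add: stepwise_def\<close>)
  with v show ?thesis
    unfolding approximations_stepwise by (intro CollectI exI[of _ v] conjI)
qed

text \<open>The scale \<open>\<beta>\<close> defining E is kept apart from the scale
  \<open>\<alpha>\<close> of the approximations, so the bound covers E computed from any admissible
  scale.\<close>

theorem corollary4p6:
  fixes f :: "real \<Rightarrow> 'a::euclidean_space \<Rightarrow> 'a"
    and U :: "(real \<times> 'a) set"
    and x :: "real \<Rightarrow> 'a" and x0 :: 'a
    and \<alpha> \<beta> :: "real \<Rightarrow> real"
    and T \<epsilon> :: real
  assumes "openin (top_of_set ({0..} \<times> UNIV)) U"
    and "continuous_in_time f U"
    and "locally_lipschitz_in_state f U"
    and "ode_solution f U {0..} x" and "x 0 = x0"
    and "admissible_scale \<beta>"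
    and "admissible_scale \<alpha>"
    and "T > 0" and "\<epsilon> > 0"
  shows "\<exists>h0>0. \<forall>h. 0 < h \<and> h < h0 \<longrightarrow>
    (\<forall>xt \<in> approximations f U \<alpha> x0 h T. \<forall>t\<in>{0..T}.
       ereal (norm (xt t - x t)) < (associated_E f U x \<beta> t + ereal \<epsilon>) * ereal (\<alpha> h))"
proof -
  let ?F = "\<lambda>t y. f t (y + x t) - f t (x t)" and ?V = "{(t, y). (t, y + x t) \<in> U}"
  obtain L \<rho> where "tube ?F ?V L \<rho> T"
    using tube_around_solution[OF assms(1-4,8)] by blast
  then have "\<forall>\<^sub>F h in at_right 0. \<forall>y\<in>approximations ?F ?V \<alpha> 0 h T. \<forall>t\<in>{0..T}.
      ereal (norm (y t)) < (associated_E f U x \<beta> t + ereal \<epsilon>) * ereal (\<alpha> h)"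
    unfolding associated_E_def using assms(7,6,9) by (rule tube.approximation_error)
  then obtain h0 where "0 < h0" and h0: "\<And>h. 0 < h \<Longrightarrow> h < h0 \<Longrightarrow>
      \<forall>y\<in>approximations ?F ?V \<alpha> 0 h T. \<forall>t\<in>{0..T}.
        ereal (norm (y t)) < (associated_E f U x \<beta> t + ereal \<epsilon>) * ereal (\<alpha> h)"
    unfolding eventually_at_right_field by blast
  show ?thesis
  proof (intro exI[of _ h0] conjI allI impI ballI)
    fix h xt t assume h: "0 < h \<and> h < h0" and xt: "xt \<in> approximations f U \<alpha> x0 h T"
      and t: "t \<in> {0..T}"
    have "(\<lambda>t. xt t - x t) \<in> approximations ?F ?V \<alpha> 0 h T"
      by (rule approximations_deviation[OF assms(4)]) (use h xt assms(5) in auto)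
    from bspec[OF bspec[OF h0 this] t]
    show "ereal (norm (xt t - x t)) < (associated_E f U x \<beta> t + ereal \<epsilon>) * ereal (\<alpha> h)"
      using h by simp
  qed fact
qed

end
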